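(* Let $\Gamma$ be a finite abelian group. The map $\mathrm{ganit}_v(\mathrm{pic})$ induces a group isomorphism from $(\overline{\mathrm{GARI}}(\Gamma)_{\mathrm{as}},\times)$ to $(\overline{\mathrm{GARI}}(\Gamma)_{\mathrm{is}},\times)$ and induces a Lie algebra isomorphism from $(\overline{\mathrm{ARI}}(\Gamma)_{\mathrm{al}},[\,,])$ to $(\overline{\mathrm{ARI}}(\Gamma)_{\mathrm{il}},[\,,])$.
   Context: Moulds. $\Gamma$ is a finite abelian group, written multiplicatively. A mould is a sequence $M=(M(x_1,\dots,x_m))_{m\ge 0}$ with $M(\emptyset)\in\mathbb{Q}$ and, for $m\ge1$, $M(x_1,\dots,x_m)$ a family of rational functions $M_{\sigma_1,\dots,\sigma_m}(x_1,\dots,x_m)\in\mathbb{Q}(x_1,\dots,x_m)$ indexed by $(\sigma_1,\dots,\sigma_m)\in\Gamma^{m}$. $\overline{\mathrm{BIMU}}(\Gamma)$ denotes the set of all moulds, with variables called $v_i$ and components written $M\binom{\sigma_1,\dots,\sigma_m}{v_1,\dots,v_m}$. It is a $\mathbb{Q}$-vector space componentwise and a unital associative algebra with product $(A\times B)_{\sigma_1,\dots,\sigma_m}(x_1,\dots,x_m)=\sum_{i=0}^m A_{\sigma_1,\dots,\sigma_i}(x_1,\dots,x_i)B_{\sigma_{i+1},\dots,\sigma_m}(x_{i+1},\dots,x_m)$ and unit $I=(1,0,0,\dots)$. Put $[A,B]=A\times B-B\times A$, $\overline{\mathrm{ARI}}(\Gamma)=\{M: M(\emptyset)=0\}$ (a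 Lie algebra under $[\,,]$), $\overline{\mathrm{GARI}}(\Gamma)=\{M: M(\emptyset)=1\}$ (a group under $\times$). Words. $V_{\mathbb Z}$ is the set of letters $\binom{\sigma}{v}$ with $\sigma\in\Gamma$ and $v$ a $\mathbb{Z}$-linear combination of $v_1,v_2,\dots$; $V_{\mathbb Z}^\bullet$ is the free monoid on $V_{\mathbb Z}$ with empty word $\emptyset$. For a word $\alpha=(\binom{\sigma_1}{w_1},\dots,\binom{\sigma_m}{w_m})$, $M(\alpha):=M_{\sigma_1,\dots,\sigma_m}(w_1,\dots,w_m)$ (only used when $w_1,\dots,w_m$ are linearly independent). Write $\omega_i=\binom{\sigma_i}{v_i}$ and $\mathbf v_r=(\omega_1,\dots,\omega_r)$, $\mathbf v_0=\emptyset$. Let $\mathcal K=\mathbb{Q}(v_i\mid i\ge1)$. Shuffles. On $\mathcal A_V=\mathcal K\langle V_{\mathbb Z}\rangle$ (the $\mathcal K$-span of $V_{\mathbb Z}^\bullet$) define $\mathcal K$-bilinear products with unit $\emptyset$: $a\omega\sqcup\!\sqcup b\eta=a(\omega\sqcup\!\sqcup b\eta)+b(a\omega\sqcup\!\sqcup\eta)$ for letters $a,b$ and words $\omega,\eta$; and, for $v\ne v'$, $\binom{\sigma}{v}\omega\sqcup\!\sqcup_*\binom{\sigma'}{v'}\eta=\binom{\sigma}{v}(\omega\sqcup\!\sqcup_*\binom{\sigma'}{v'}\eta)+\binom{\sigma'}{v'}(\binom{\sigma}{v}\omega\sqcup\!\sqcup_*\eta)+\frac1{v-v'}\{\binom{\sigma\sigma'}{v}(\omega\sqcup\!\sqcup_*\eta)-\binom{\sigma\sigma'}{v'}(\omega\sqcup\!\sqcup_*\eta)\}$,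 the product being $0$ if $v=v'$. Let $\mathrm{Sh}\binom{\omega;\eta}{\alpha}$ and $\mathrm{Sh}_*\binom{\omega;\eta}{\alpha}$ be the coefficients of the word $\alpha$ in $\omega\sqcup\!\sqcup\eta$ and $\omega\sqcup\!\sqcup_*\eta$. Symmetry types. $M\in\overline{\mathrm{ARI}}(\Gamma)$ (resp. $M\in\overline{\mathrm{GARI}}(\Gamma)$) is alternal (resp. symmetral) if for all $p,q\ge1$ and all $\sigma_i\in\Gamma$, with $\omega=(\omega_1,\dots,\omega_p)$, $\eta=(\omega_{p+1},\dots,\omega_{p+q})$, one has $\sum_{\alpha}\mathrm{Sh}\binom{\omega;\eta}{\alpha}M(\alpha)=0$ (resp. $=M(\omega)M(\eta)$). It is alternil (resp. symmetril) if the same holds with $\mathrm{Sh}_*$ in place of $\mathrm{Sh}$. The sets of alternal, alternil, symmetral, symmetril moulds are denoted $\overline{\mathrm{ARI}}(\Gamma)_{\mathrm{al}}$, $\overline{\mathrm{ARI}}(\Gamma)_{\mathrm{il}}$, $\overline{\mathrm{GARI}}(\Gamma)_{\mathrm{as}}$, $\overline{\mathrm{GARI}}(\Gamma)_{\mathrm{is}}$. They are respectively Lie subalgebras of $(\overline{\mathrm{ARI}}(\Gamma),[\,,])$ (first two) and subgroups of $(\overline{\mathrm{GARI}}(\Gamma),\times)$ (last two). Flexions. For nonempty words $a=(\binom{\tau_1}{y_1},\dots,\binom{\tau_k}{y_k})$, $b=(\binom{\rho_1}{z_1},\dots,\binom{\rho_l}{z_l})$: $a\rceil_b$ is $a$ with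 its last letter replaced by $\binom{\tau_k\rho_1\cdots\rho_l}{y_k}$, and ${}_a\lfloor b=(\binom{\rho_1}{z_1-y_k},\dots,\binom{\rho_l}{z_l-y_k})$; moreover $a\rceil_\emptyset=a$, ${}_a\lfloor\emptyset=\emptyset$. The map $\mathrm{ganit}_v(B)$. For $B\in\overline{\mathrm{GARI}}(\Gamma)$, the $\mathbb{Q}$-linear map $\mathrm{ganit}_v(B):\overline{\mathrm{BIMU}}(\Gamma)\to\overline{\mathrm{BIMU}}(\Gamma)$ is given by $(\mathrm{ganit}_v(B)(A))(\emptyset)=A(\emptyset)$ and, for $r\ge1$, $$(\mathrm{ganit}_v(B)(A))(\mathbf v_r)=\sum_{s\ge1}\ \sum_{\substack{\mathbf v_r=a_1b_1\cdots a_sb_s\\ a_1,\dots,a_s\ne\emptyset\\ b_1,\dots,b_{s-1}\ne\emptyset}}B({}_{a_1}\lfloor b_1)\cdots B({}_{a_s}\lfloor b_s)\,A(a_1\rceil_{b_1}\cdots a_s\rceil_{b_s}).$$ The mould $\mathrm{pic}\in\overline{\mathrm{GARI}}(\Gamma)$ is $\mathrm{pic}(\emptyset)=1$, $\mathrm{pic}(\mathbf v_m)=\frac1{v_1v_2\cdots v_m}$ for all $\sigma_i$. *)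

theory Defs
  imports
    Complex_Main
    "HOL-Algebra.Group"
    "HOL-Library.Poly_Mapping"
    "HOL-Library.FuncSet"
    "HOL-Computational_Algebra.Fraction_Field"
begin

section \<open>Rational functions in countably many variables\<close>

text \<open>
  The index \<open>i :: nat\<close> stands for the variable \<open>v\<^sub>i\<^sub>+\<^sub>1\<close> (equivalently \<open>x\<^sub>i\<^sub>+\<^sub>1\<close>), so that the \<open>i\<close>-th
  entry of a list, counted from 0, goes with the variable of index \<open>i\<close>. With this convention
  \<open>ratfun\<close> is the field \<open>\<rat>(v\<^sub>i | i \<ge> 1)\<close>.
\<close>

type_synonym qpoly = "(nat \<Rightarrow>\<^sub>0 nat) \<Rightarrow>\<^sub>0 rat"
type_synonym ratfun = "qpoly fract"

definition qpoly_const :: "rat \<Rightarrow> qpoly" where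
  "qpoly_const c = Poly_Mapping.single 0 c"

definition qpoly_var :: "nat \<Rightarrow> qpoly" where
  "qpoly_var i = Poly_Mapping.single (Poly_Mapping.single i 1) 1"

definition qpoly_vars :: "qpoly \<Rightarrow> nat set" where
  "qpoly_vars p = (\<Union>m\<in>Poly_Mapping.keys p. Poly_Mapping.keys m)"

definition qpoly_subst :: "(nat \<Rightarrow> qpoly) \<Rightarrow> qpoly \<Rightarrow> qpoly" where
  "qpoly_subst f p =
    (\<Sum>m\<in>Poly_Mapping.keys p. qpoly_const (Poly_Mapping.lookup p m) *
       (\<Prod>i\<in>Poly_Mapping.keys m. f i ^ Poly_Mapping.lookup m i))"

text \<open>The subfield \<open>\<rat>(x\<^sub>1, \<dots>, x\<^sub>m)\<close>; for \<open>m = 0\<close> this is the field of rational constants.\<close>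

definition ratfuns :: "nat \<Rightarrow> ratfun set" where
  "ratfuns m = {Fract p q | p q.
     q \<noteq> 0 \<and> qpoly_vars p \<subseteq> {..<m} \<and> qpoly_vars q \<subseteq> {..<m}}"

text \<open>\<open>\<int>\<close>-linear combinations of the variables \<open>v\<^sub>1, v\<^sub>2, \<dots>\<close>.\<close>

type_synonym lincomb = "nat \<Rightarrow>\<^sub>0 int"

definition lin_var :: "nat \<Rightarrow> lincomb" where
  "lin_var i = Poly_Mapping.single i 1"

definition lin_poly :: "lincomb \<Rightarrow> qpoly" where
  "lin_poly w = (\<Sum>i\<in>Poly_Mapping.keys w. qpoly_const (of_int (Poly_Mapping.lookup w i)) * qpoly_var i)"

definition lin_ratfun :: "lincomb \<Rightarrow> ratfun" where
  "lin_ratfun w = Fract (lin_poly w) 1"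

text \<open>
  The value \<open>f(w\<^sub>1, \<dots>, w\<^sub>m)\<close>, computed from any fraction representing \<open>f\<close> whose denominator does
  not vanish under the substitution; it does not depend on the fraction. If \<open>f \<in> ratfuns m\<close> and
  \<open>w\<^sub>1, \<dots>, w\<^sub>m\<close> are linearly independent, such a fraction exists. The variables beyond
  \<open>x\<^sub>m\<close>, which do not occur in \<open>f\<close>, are sent to 0.
\<close>

definition ratfun_eval :: "ratfun \<Rightarrow> lincomb list \<Rightarrow> ratfun" where
  "ratfun_eval f ws =
    (let s = qpoly_subst (\<lambda>i. if i < length ws then lin_poly (ws ! i) else 0)
     in (THE g. \<exists>p q. f = Fract p q \<and> s q \<noteq> 0 \<and> g = Fract (s p) (s q)))"


section \<open>Moulds\<close>

type_synonym 'g mould = "'g list \<Rightarrow> ratfun"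

text \<open>
  \<open>M [\<sigma>\<^sub>1, \<dots>, \<sigma>\<^sub>m]\<close> is the component \<open>M\<^bsub>\<sigma>\<^sub>1,\<dots>,\<sigma>\<^sub>m\<^esub>(x\<^sub>1, \<dots>, x\<^sub>m)\<close>. Outside the lists over the carrier
  of the group, moulds are \<open>undefined\<close>, as usual for \<open>\<Pi>\<^sub>E\<close>.
\<close>

definition BIMU :: "('g, 'b) monoid_scheme \<Rightarrow> 'g mould set" where
  "BIMU \<Gamma> = (\<Pi>\<^sub>E \<sigma>s\<in>lists (carrier \<Gamma>). ratfuns (length \<sigma>s))"

definition ARI :: "('g, 'b) monoid_scheme \<Rightarrow> 'g mould set" where
  "ARI \<Gamma> = {M \<in> BIMU \<Gamma>. M [] = 0}"

definition GARI :: "('g, 'b) monoid_scheme \<Rightarrow> 'g mould set" where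
  "GARI \<Gamma> = {M \<in> BIMU \<Gamma>. M [] = 1}"

type_synonym 'g letter = "'g \<times> lincomb"
type_synonym 'g word = "'g letter list"

definition mould_at :: "'g mould \<Rightarrow> 'g word \<Rightarrow> ratfun" where
  "mould_at M \<alpha> = ratfun_eval (M (map fst \<alpha>)) (map snd \<alpha>)"

text \<open>
  The word with group entries \<open>\<sigma>s\<close> and the consecutive variables \<open>v\<^sub>k\<^sub>+\<^sub>1, v\<^sub>k\<^sub>+\<^sub>2, \<dots>\<close>.
  In particular \<open>var_word 0 [\<sigma>\<^sub>1, \<dots>, \<sigma>\<^sub>r]\<close> is the word \<open>(\<omega>\<^sub>1, \<dots>, \<omega>\<^sub>r)\<close>.
\<close>

definition var_word :: "nat \<Rightarrow> 'g list \<Rightarrow> 'g word" where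
  "var_word k \<sigma>s = zip \<sigma>s (map lin_var [k..<k + length \<sigma>s])"

definition mould_add :: "('g, 'b) monoid_scheme \<Rightarrow> 'g mould \<Rightarrow> 'g mould \<Rightarrow> 'g mould" where
  "mould_add \<Gamma> A B = (\<lambda>\<sigma>s\<in>lists (carrier \<Gamma>). A \<sigma>s + B \<sigma>s)"

definition mould_smult :: "('g, 'b) monoid_scheme \<Rightarrow> rat \<Rightarrow> 'g mould \<Rightarrow> 'g mould" where
  "mould_smult \<Gamma> c A = (\<lambda>\<sigma>s\<in>lists (carrier \<Gamma>). Fract (qpoly_const c) 1 * A \<sigma>s)"

definition mould_mult :: "('g, 'b) monoid_scheme \<Rightarrow> 'g mould \<Rightarrow> 'g mould \<Rightarrow> 'g mould" where
  "mould_mult \<Gamma> A B = (\<lambda>\<sigma>s\<in>lists (carrier \<Gamma>).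
     \<Sum>i\<le>length \<sigma>s. mould_at A (take i (var_word 0 \<sigma>s)) * mould_at B (drop i (var_word 0 \<sigma>s)))"

definition mould_one :: "('g, 'b) monoid_scheme \<Rightarrow> 'g mould" where
  "mould_one \<Gamma> = (\<lambda>\<sigma>s\<in>lists (carrier \<Gamma>). if \<sigma>s = [] then 1 else 0)"

definition mould_bracket :: "('g, 'b) monoid_scheme \<Rightarrow> 'g mould \<Rightarrow> 'g mould \<Rightarrow> 'g mould" where
  "mould_bracket \<Gamma> A B =
     (\<lambda>\<sigma>s\<in>lists (carrier \<Gamma>). mould_mult \<Gamma> A B \<sigma>s - mould_mult \<Gamma> B A \<sigma>s)"

definition GARI_group :: "('g, 'b) monoid_scheme \<Rightarrow> 'g mould monoid" where
  "GARI_group \<Gamma> = \<lparr>carrier = GARI \<Gamma>, mult = mould_mult \<Gamma>, one = mould_one \<Gamma>\<rparr>"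

text \<open>The operations of a Lie algebra over \<open>\<rat>\<close>, and isomorphisms, in the style of \<^const>\<open>iso\<close>.\<close>

record 'a lie_struct = "'a partial_object" +
  lie_add :: "'a \<Rightarrow> 'a \<Rightarrow> 'a"
  lie_smult :: "rat \<Rightarrow> 'a \<Rightarrow> 'a"
  lie_bracket :: "'a \<Rightarrow> 'a \<Rightarrow> 'a"

definition lie_iso :: "('a, 'c) lie_struct_scheme \<Rightarrow> ('b, 'd) lie_struct_scheme \<Rightarrow> ('a \<Rightarrow> 'b) set" where
  "lie_iso L L' = {h. bij_betw h (carrier L) (carrier L') \<and>
     (\<forall>x\<in>carrier L. \<forall>y\<in>carrier L. h (lie_add L x y) = lie_add L' (h x) (h y)) \<and>
     (\<forall>c. \<forall>x\<in>carrier L. h (lie_smult L c x) = lie_smult L' c (h x)) \<and>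
     (\<forall>x\<in>carrier L. \<forall>y\<in>carrier L. h (lie_bracket L x y) = lie_bracket L' (h x) (h y))}"

definition ARI_lie :: "('g, 'b) monoid_scheme \<Rightarrow> 'g mould lie_struct" where
  "ARI_lie \<Gamma> = \<lparr>carrier = ARI \<Gamma>, lie_add = mould_add \<Gamma>, lie_smult = mould_smult \<Gamma>,
     lie_bracket = mould_bracket \<Gamma>\<rparr>"


section \<open>Shuffle products and symmetry types\<close>

text \<open>
  The \<open>ratfun\<close>-span of the words is the type \<open>'g word \<Rightarrow>\<^sub>0 ratfun\<close>. The two bilinear products are
  determined by their values on words, which is all that is defined here.
\<close>

definition span_smult :: "ratfun \<Rightarrow> ('g word \<Rightarrow>\<^sub>0 ratfun) \<Rightarrow> ('g word \<Rightarrow>\<^sub>0 ratfun)" where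
  "span_smult c = Poly_Mapping.map ((*) c)"

text \<open>Left concatenation with a letter, extended linearly.\<close>

definition span_Cons :: "'g letter \<Rightarrow> ('g word \<Rightarrow>\<^sub>0 ratfun) \<Rightarrow> ('g word \<Rightarrow>\<^sub>0 ratfun)" where
  "span_Cons a P =
     (\<Sum>\<alpha>\<in>Poly_Mapping.keys P. Poly_Mapping.single (a # \<alpha>) (Poly_Mapping.lookup P \<alpha>))"

fun shuffle :: "'g word \<Rightarrow> 'g word \<Rightarrow> ('g word \<Rightarrow>\<^sub>0 ratfun)" where
  "shuffle [] \<eta> = Poly_Mapping.single \<eta> 1"
| "shuffle \<omega> [] = Poly_Mapping.single \<omega> 1"
| "shuffle (a # \<omega>) (b # \<eta>) =
     span_Cons a (shuffle \<omega> (b # \<eta>)) + span_Cons b (shuffle (a # \<omega>) \<eta>)"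

fun stuffle :: "('g, 'b) monoid_scheme \<Rightarrow> 'g word \<Rightarrow> 'g word \<Rightarrow> ('g word \<Rightarrow>\<^sub>0 ratfun)" where
  "stuffle \<Gamma> [] \<eta> = Poly_Mapping.single \<eta> 1"
| "stuffle \<Gamma> \<omega> [] = Poly_Mapping.single \<omega> 1"
| "stuffle \<Gamma> ((\<sigma>, v) # \<omega>) ((\<sigma>', v') # \<eta>) =
     (if v = v' then 0
      else span_Cons (\<sigma>, v) (stuffle \<Gamma> \<omega> ((\<sigma>', v') # \<eta>))
         + span_Cons (\<sigma>', v') (stuffle \<Gamma> ((\<sigma>, v) # \<omega>) \<eta>)
         + span_smult (1 / lin_ratfun (v - v'))
             (span_Cons (\<sigma> \<otimes>\<^bsub>\<Gamma>\<^esub> \<sigma>', v) (stuffle \<Gamma> \<omega> \<eta>)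
              - span_Cons (\<sigma> \<otimes>\<^bsub>\<Gamma>\<^esub> \<sigma>', v') (stuffle \<Gamma> \<omega> \<eta>)))"

text \<open>\<open>\<Sum>\<^sub>\<alpha> c\<^sub>\<alpha> M(\<alpha>)\<close>, where the \<open>c\<^sub>\<alpha>\<close> are the coefficients of an element of the span of words.\<close>

definition mould_sum :: "'g mould \<Rightarrow> ('g word \<Rightarrow>\<^sub>0 ratfun) \<Rightarrow> ratfun" where
  "mould_sum M P = (\<Sum>\<alpha>\<in>Poly_Mapping.keys P. Poly_Mapping.lookup P \<alpha> * mould_at M \<alpha>)"

text \<open>
  Below, \<open>\<sigma>s\<close> and \<open>\<tau>s\<close> have lengths \<open>p, q \<ge> 1\<close>, and the two words are
  \<open>(\<omega>\<^sub>1, \<dots>, \<omega>\<^sub>p)\<close> and \<open>(\<omega>\<^sub>p\<^sub>+\<^sub>1, \<dots>, \<omega>\<^sub>p\<^sub>+\<^sub>q)\<close>.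
\<close>

definition ARI_al :: "('g, 'b) monoid_scheme \<Rightarrow> 'g mould set" where
  "ARI_al \<Gamma> = {M \<in> ARI \<Gamma>.
     \<forall>\<sigma>s\<in>lists (carrier \<Gamma>). \<forall>\<tau>s\<in>lists (carrier \<Gamma>). \<sigma>s \<noteq> [] \<longrightarrow> \<tau>s \<noteq> [] \<longrightarrow>
       mould_sum M (shuffle (var_word 0 \<sigma>s) (var_word (length \<sigma>s) \<tau>s)) = 0}"

definition ARI_il :: "('g, 'b) monoid_scheme \<Rightarrow> 'g mould set" where
  "ARI_il \<Gamma> = {M \<in> ARI \<Gamma>.
     \<forall>\<sigma>s\<in>lists (carrier \<Gamma>). \<forall>\<tau>s\<in>lists (carrier \<Gamma>). \<sigma>s \<noteq> [] \<longrightarrow> \<tau>s \<noteq> [] \<longrightarrow>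
       mould_sum M (stuffle \<Gamma> (var_word 0 \<sigma>s) (var_word (length \<sigma>s) \<tau>s)) = 0}"

definition GARI_as :: "('g, 'b) monoid_scheme \<Rightarrow> 'g mould set" where
  "GARI_as \<Gamma> = {M \<in> GARI \<Gamma>.
     \<forall>\<sigma>s\<in>lists (carrier \<Gamma>). \<forall>\<tau>s\<in>lists (carrier \<Gamma>). \<sigma>s \<noteq> [] \<longrightarrow> \<tau>s \<noteq> [] \<longrightarrow>
       mould_sum M (shuffle (var_word 0 \<sigma>s) (var_word (length \<sigma>s) \<tau>s))
       = mould_at M (var_word 0 \<sigma>s) * mould_at M (var_word (length \<sigma>s) \<tau>s)}"

definition GARI_is :: "('g, 'b) monoid_scheme \<Rightarrow> 'g mould set" where
  "GARI_is \<Gamma> = {M \<in> GARI \<Gamma>.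
     \<forall>\<sigma>s\<in>lists (carrier \<Gamma>). \<forall>\<tau>s\<in>lists (carrier \<Gamma>). \<sigma>s \<noteq> [] \<longrightarrow> \<tau>s \<noteq> [] \<longrightarrow>
       mould_sum M (stuffle \<Gamma> (var_word 0 \<sigma>s) (var_word (length \<sigma>s) \<tau>s))
       = mould_at M (var_word 0 \<sigma>s) * mould_at M (var_word (length \<sigma>s) \<tau>s)}"


section \<open>Flexions and the map \<open>ganit\<^sub>v\<close>\<close>

text \<open>
  \<open>flexion_up \<Gamma> a b\<close> is \<open>a\<rceil>\<^sub>b\<close> and \<open>flexion_low a b\<close> is \<open>\<^sub>a\<lfloor>b\<close>, for a nonempty word \<open>a\<close>. For empty \<open>b\<close>
  they reduce to \<open>a\<close> and the empty word.
\<close>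

definition flexion_up :: "('g, 'b) monoid_scheme \<Rightarrow> 'g word \<Rightarrow> 'g word \<Rightarrow> 'g word" where
  "flexion_up \<Gamma> a b =
     butlast a @ [(foldl (\<otimes>\<^bsub>\<Gamma>\<^esub>) (fst (last a)) (map fst b), snd (last a))]"

definition flexion_low :: "'g word \<Rightarrow> 'g word \<Rightarrow> 'g word" where
  "flexion_low a b = map (\<lambda>(\<rho>, z). (\<rho>, z - snd (last a))) b"

text \<open>
  The factorizations \<open>w = a\<^sub>1 b\<^sub>1 \<dots> a\<^sub>s b\<^sub>s\<close> with \<open>s \<ge> 1\<close>, encoded as \<open>[(a\<^sub>1, b\<^sub>1), \<dots>, (a\<^sub>s, b\<^sub>s)]\<close>; only
  the last \<open>b\<^sub>s\<close> may be empty.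
\<close>

definition factorizations :: "'g word \<Rightarrow> ('g word \<times> 'g word) list set" where
  "factorizations w = {abs. abs \<noteq> [] \<and> concat (map (\<lambda>(a, b). a @ b) abs) = w \<and>
     (\<forall>(a, b)\<in>set abs. a \<noteq> []) \<and> (\<forall>(a, b)\<in>set (butlast abs). b \<noteq> [])}"

definition ganit :: "('g, 'b) monoid_scheme \<Rightarrow> 'g mould \<Rightarrow> 'g mould \<Rightarrow> 'g mould" where
  "ganit \<Gamma> B A = (\<lambda>\<sigma>s\<in>lists (carrier \<Gamma>).
     if \<sigma>s = [] then A []
     else \<Sum>abs\<in>factorizations (var_word 0 \<sigma>s).
            (\<Prod>(a, b)\<leftarrow>abs. mould_at B (flexion_low a b))
            * mould_at A (concat (map (\<lambda>(a, b). flexion_up \<Gamma> a b) abs)))"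

definition pic :: "('g, 'b) monoid_scheme \<Rightarrow> 'g mould" where
  "pic \<Gamma> = (\<lambda>\<sigma>s\<in>lists (carrier \<Gamma>). 1 / (\<Prod>i<length \<sigma>s. lin_ratfun (lin_var i)))"

end

(*
  ganit_v(pic) is dual to the linear map phi on words that cuts a word into nonempty blocks and replaces a block
  (t,y)(r_1,z_1)...(r_l,z_l) by the single letter (t r_1 ... r_l, y) with coefficient 1 / prod_i (z_i - y).
  Since phi is built from blocks it is compatible with deconcatenation, so ganit_v(pic) is multiplicative.
  The coefficient of a block is a character of the quasi-shuffle product, by partial fractions, and this
  makes phi a homomorphism from the quasi-shuffle to the shuffle product. As phi is unipotent it is
  invertible, with an explicit recursive inverse, and therefore exchanges the two symmetry types.
*)

theory Submission
  imports Defs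
begin

section \<open>Substitution of variables in rational functions\<close>

text \<open>A mould is stored only through its components at the standard variables, whereas
  flexions and both shuffle recursions move to other words. The calculation therefore concerns
  arbitrary functionals on words whose letters are pairs of a group element and a variable index.
  Moulds reappear as those functionals that commute with injective renamings and whose values
  involve only the variables of the word. Words are restricted to pairwise distinct variables: there
  no weight 1/(v - v') degenerates and every substitution is an injective renaming. Recursions
  change the functional, \<open>f\<close> becoming u -> f(x u), which replaces manipulations of
  finitely supported sums. The partial fraction identity in question is 1/(z - y) (1/(z - x) - 1/(y
  - x)) = -1/((z - x)(y - x)). It is applied one letter at a time, to the half of the product whose
  leading letter comes from the first word; commutativity of \<Gamma> yields the other half. The
  passage from quasi-shuffle symmetry back to shuffle symmetry inverts phi in the two words
  separately, so the inverse of phi never has to be shown to be a homomorphism.\<close>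

definition monom_subst :: "(nat \<Rightarrow> qpoly) \<Rightarrow> (nat \<Rightarrow>\<^sub>0 nat) \<Rightarrow> qpoly" where
  "monom_subst f m = (\<Prod>i\<in>Poly_Mapping.keys m. f i ^ Poly_Mapping.lookup m i)"

lemma monom_subst_superset:
  "finite S \<Longrightarrow> Poly_Mapping.keys m \<subseteq> S \<Longrightarrow> monom_subst f m = (\<Prod>i\<in>S. f i ^ Poly_Mapping.lookup m i)"
  unfolding monom_subst_def by (rule prod.mono_neutral_left) (auto simp: in_keys_iff)

lemma monom_subst_add: "monom_subst f (m + n) = monom_subst f m * monom_subst f n"
proof -
  let ?S = "Poly_Mapping.keys m \<union> Poly_Mapping.keys n"
  have "Poly_Mapping.keys (m + n) \<subseteq> ?S" by (rule keys_add)
  then show ?thesis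
    by (simp add: monom_subst_superset[of ?S] lookup_add power_add prod.distrib)
qed

lemma qpoly_subst_superset:
  "finite S \<Longrightarrow> Poly_Mapping.keys p \<subseteq> S \<Longrightarrow>
    qpoly_subst f p = (\<Sum>m\<in>S. qpoly_const (Poly_Mapping.lookup p m) * monom_subst f m)"
  unfolding qpoly_subst_def monom_subst_def[symmetric]
  by (rule sum.mono_neutral_left) (auto simp: in_keys_iff qpoly_const_def)

lemma qpoly_const_add: "qpoly_const (a + b) = qpoly_const a + qpoly_const b"
  by (simp add: qpoly_const_def single_add)

lemma qpoly_const_mult: "qpoly_const (a * b) = qpoly_const a * qpoly_const b"
  by (simp add: qpoly_const_def mult_single)

lemma qpoly_const_0 [simp]: "qpoly_const 0 = 0" and qpoly_const_1 [simp]: "qpoly_const 1 = 1"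
  by (simp_all add: qpoly_const_def)

lemma qpoly_subst_add: "qpoly_subst f (p + q) = qpoly_subst f p + qpoly_subst f q"
proof -
  let ?S = "Poly_Mapping.keys p \<union> Poly_Mapping.keys q"
  have "Poly_Mapping.keys (p + q) \<subseteq> ?S" by (rule keys_add)
  then show ?thesis
    by (simp add: qpoly_subst_superset[of ?S] lookup_add qpoly_const_add distrib_right sum.distrib)
qed

lemma qpoly_subst_single: "qpoly_subst f (Poly_Mapping.single m c) = qpoly_const c * monom_subst f m"
  by (cases "c = 0") (simp_all add: qpoly_subst_superset[of "{m}"] lookup_single)

lemma qpoly_subst_0 [simp]: "qpoly_subst f 0 = 0"
  by (simp add: qpoly_subst_def)

lemma qpoly_subst_const [simp]: "qpoly_subst f (qpoly_const c) = qpoly_const c"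
  unfolding qpoly_const_def qpoly_subst_single by (simp add: monom_subst_def qpoly_const_def)

lemma qpoly_subst_1 [simp]: "qpoly_subst f 1 = 1"
  using qpoly_subst_const[of f 1] by simp

lemma qpoly_subst_var [simp]: "qpoly_subst f (qpoly_var i) = f i"
  by (simp add: qpoly_var_def qpoly_subst_single monom_subst_def)

lemma qpoly_subst_sum: "qpoly_subst f (\<Sum>i\<in>A. g i) = (\<Sum>i\<in>A. qpoly_subst f (g i))"
  by (induction A rule: infinite_finite_induct) (simp_all add: qpoly_subst_add)

lemma qpoly_sum_monomials: "p = (\<Sum>m\<in>Poly_Mapping.keys p. Poly_Mapping.single m (Poly_Mapping.lookup p m))"
  for p :: qpoly
  by (rule poly_mapping_eqI) (simp add: lookup_sum lookup_single when_def in_keys_iff)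

lemma qpoly_subst_mult: "qpoly_subst f (p * q) = qpoly_subst f p * qpoly_subst f q"
proof -
  have 1: "qpoly_subst f (Poly_Mapping.single m c * Poly_Mapping.single n d) =
    qpoly_subst f (Poly_Mapping.single m c) * qpoly_subst f (Poly_Mapping.single n d)" for m n c d
    by (simp add: mult_single qpoly_subst_single monom_subst_add qpoly_const_mult mult_ac)
  have sums: "qpoly_subst f ((\<Sum>m\<in>M. Poly_Mapping.single m (c m)) * (\<Sum>n\<in>N. Poly_Mapping.single n (d n))) =
    qpoly_subst f (\<Sum>m\<in>M. Poly_Mapping.single m (c m)) * qpoly_subst f (\<Sum>n\<in>N. Poly_Mapping.single n (d n))"
    for M N c d
    by (simp only: sum_product qpoly_subst_sum 1)
  show ?thesis
    using sums[of "Poly_Mapping.lookup p" "Poly_Mapping.keys p" "Poly_Mapping.lookup q" "Poly_Mapping.keys q"]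
    unfolding qpoly_sum_monomials[symmetric] .
qed

lemma qpoly_subst_prod: "qpoly_subst f (\<Prod>i\<in>A. g i) = (\<Prod>i\<in>A. qpoly_subst f (g i))"
  by (induction A rule: infinite_finite_induct) (simp_all add: qpoly_subst_mult)

lemma qpoly_subst_power: "qpoly_subst f (p ^ n) = qpoly_subst f p ^ n"
  by (induction n) (simp_all add: qpoly_subst_mult)

lemma qpoly_subst_comp: "qpoly_subst f (qpoly_subst g p) = qpoly_subst (\<lambda>i. qpoly_subst f (g i)) p"
  by (simp add: qpoly_subst_def[of g] qpoly_subst_def[of "\<lambda>i. qpoly_subst f (g i)"]
      qpoly_subst_sum qpoly_subst_mult qpoly_subst_prod qpoly_subst_power)

lemma qpoly_subst_cong: "(\<And>i. i \<in> qpoly_vars p \<Longrightarrow> f i = g i) \<Longrightarrow> qpoly_subst f p = qpoly_subst g p"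
  unfolding qpoly_subst_def qpoly_vars_def
  by (intro sum.cong refl arg_cong2[where f = "(*)"] prod.cong arg_cong2[where f = "(^)"]) auto

lemma monom_subst_var: "monom_subst qpoly_var m = Poly_Mapping.single m 1"
proof -
  have pw: "qpoly_var i ^ n = Poly_Mapping.single (Poly_Mapping.single i n) 1" for i n
    by (induction n) (simp_all add: qpoly_var_def mult_single single_one flip: single_add)
  have ps: "(\<Prod>i\<in>A. Poly_Mapping.single (h i) 1) = (Poly_Mapping.single (\<Sum>i\<in>A. h i) 1 :: qpoly)"
    for A and h :: "nat \<Rightarrow> nat \<Rightarrow>\<^sub>0 nat"
    by (induction A rule: infinite_finite_induct) (simp_all add: mult_single)
  have "(\<Sum>i\<in>Poly_Mapping.keys m. Poly_Mapping.single i (Poly_Mapping.lookup m i)) = m"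
    by (rule poly_mapping_eqI) (simp add: lookup_sum lookup_single when_def in_keys_iff)
  then show ?thesis by (simp add: monom_subst_def pw ps)
qed

lemma qpoly_subst_id [simp]: "qpoly_subst qpoly_var p = p"
proof -
  have "qpoly_subst qpoly_var p = (\<Sum>m\<in>Poly_Mapping.keys p. Poly_Mapping.single m (Poly_Mapping.lookup p m))"
    unfolding qpoly_subst_def monom_subst_def[symmetric] monom_subst_var
    by (simp add: qpoly_const_def mult_single)
  then show ?thesis unfolding qpoly_sum_monomials[symmetric] .
qed

section \<open>Variables occurring in a polynomial\<close>

lemma qpoly_vars_add: "qpoly_vars p \<subseteq> S \<Longrightarrow> qpoly_vars q \<subseteq> S \<Longrightarrow> qpoly_vars (p + q) \<subseteq> S"
  using keys_add[of p q] unfolding qpoly_vars_def by blast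

lemma qpoly_vars_uminus [simp]: "qpoly_vars (- p) = qpoly_vars p"
  by (simp add: qpoly_vars_def keys_def)

lemma qpoly_vars_mult:
  assumes "qpoly_vars p \<subseteq> S" "qpoly_vars q \<subseteq> S"
  shows "qpoly_vars (p * q) \<subseteq> S"
proof
  fix i assume "i \<in> qpoly_vars (p * q)"
  then obtain m where "m \<in> Poly_Mapping.keys (p * q)" "i \<in> Poly_Mapping.keys m"
    by (auto simp: qpoly_vars_def)
  then obtain a b where "a \<in> Poly_Mapping.keys p" "b \<in> Poly_Mapping.keys q" "i \<in> Poly_Mapping.keys (a + b)"
    using keys_mult[of p q] by blast
  then show "i \<in> S"
    using keys_add[of a b] assms unfolding qpoly_vars_def by blast
qed

lemma qpoly_vars_const [simp]: "qpoly_vars (qpoly_const c) = {}"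
  by (auto simp: qpoly_vars_def qpoly_const_def split: if_splits)

lemma qpoly_vars_0 [simp]: "qpoly_vars 0 = {}" and qpoly_vars_1 [simp]: "qpoly_vars 1 = {}"
  by (simp_all add: qpoly_vars_def)

lemma qpoly_vars_var [simp]: "qpoly_vars (qpoly_var i) = {i}"
  by (simp add: qpoly_vars_def qpoly_var_def)

lemma qpoly_vars_sum: "(\<And>i. i \<in> A \<Longrightarrow> qpoly_vars (g i) \<subseteq> S) \<Longrightarrow> qpoly_vars (\<Sum>i\<in>A. g i) \<subseteq> S"
  by (induction A rule: infinite_finite_induct) (simp_all add: qpoly_vars_add)

lemma qpoly_vars_prod: "(\<And>i. i \<in> A \<Longrightarrow> qpoly_vars (g i) \<subseteq> S) \<Longrightarrow> qpoly_vars (\<Prod>i\<in>A. g i) \<subseteq> S"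
  by (induction A rule: infinite_finite_induct) (simp_all add: qpoly_vars_mult)

lemma qpoly_vars_power: "qpoly_vars p \<subseteq> S \<Longrightarrow> qpoly_vars (p ^ n) \<subseteq> S"
  by (induction n) (simp_all add: qpoly_vars_mult)

lemma qpoly_vars_subst:
  "(\<And>i. i \<in> qpoly_vars p \<Longrightarrow> qpoly_vars (f i) \<subseteq> S) \<Longrightarrow> qpoly_vars (qpoly_subst f p) \<subseteq> S"
  unfolding qpoly_subst_def qpoly_vars_def[of p]
  by (intro qpoly_vars_sum qpoly_vars_mult qpoly_vars_prod qpoly_vars_power) auto

lemma ratfunsE:
  assumes "f \<in> ratfuns n"
  obtains p q where "f = Fract p q" "q \<noteq> 0" "qpoly_vars p \<subseteq> {..<n}" "qpoly_vars q \<subseteq> {..<n}"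
  using assms by (auto simp: ratfuns_def)

lemma ratfunsI:
  "q \<noteq> 0 \<Longrightarrow> qpoly_vars p \<subseteq> {..<n} \<Longrightarrow> qpoly_vars q \<subseteq> {..<n} \<Longrightarrow> Fract p q \<in> ratfuns n"
  by (auto simp: ratfuns_def)

text \<open>This is the description inside \<open>ratfun_eval\<close> for a general substitution
  \<open>s\<close>, so that evaluation of moulds and renaming of variables are instances of one
  operator.\<close>

definition fract_map :: "(qpoly \<Rightarrow> qpoly) \<Rightarrow> ratfun \<Rightarrow> ratfun" where
  "fract_map s f = (THE g. \<exists>p q. f = Fract p q \<and> s q \<noteq> 0 \<and> g = Fract (s p) (s q))"

text \<open>If p/q = p'/q', then p q' = p' q, and multiplicativity carries this relation through the
  substitution; as both new denominators are nonzero, the described value is unique.\<close>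

lemma fract_map_subst_Fract:
  assumes "qpoly_subst h q \<noteq> 0"
  shows "fract_map (qpoly_subst h) (Fract p q) = Fract (qpoly_subst h p) (qpoly_subst h q)"
  unfolding fract_map_def
proof (rule the_equality)
  fix g assume "\<exists>p' q'. Fract p q = Fract p' q' \<and> qpoly_subst h q' \<noteq> 0 \<and>
    g = Fract (qpoly_subst h p') (qpoly_subst h q')"
  then obtain p' q' where *: "Fract p q = Fract p' q'" "qpoly_subst h q' \<noteq> 0"
    "g = Fract (qpoly_subst h p') (qpoly_subst h q')"
    by blast
  from assms *(2) have "q \<noteq> 0" "q' \<noteq> 0" by auto
  with *(1) have "p * q' = p' * q" by (simp add: eq_fract)
  then have "qpoly_subst h p * qpoly_subst h q' = qpoly_subst h p' * qpoly_subst h q"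
    by (metis qpoly_subst_mult)
  with assms *(2,3) show "g = Fract (qpoly_subst h p) (qpoly_subst h q)"
    by (simp add: eq_fract)
qed (use assms in blast)

section \<open>Injective renamings as field homomorphisms\<close>

definition rename_qpoly :: "(nat \<Rightarrow> nat) \<Rightarrow> qpoly \<Rightarrow> qpoly" where
  "rename_qpoly \<pi> = qpoly_subst (\<lambda>i. qpoly_var (\<pi> i))"

text \<open>A further substitution by a left inverse of \<pi> undoes the renaming. Hence no
  denominator is lost and the renaming extends to all rational functions.\<close>

lemma rename_qpoly_eq_0_iff [simp]: "inj \<pi> \<Longrightarrow> rename_qpoly \<pi> p = 0 \<longleftrightarrow> p = 0"
proof
  assume "inj \<pi>" "rename_qpoly \<pi> p = 0"
  then have "qpoly_subst (\<lambda>i. qpoly_var (inv_into UNIV \<pi> i)) (rename_qpoly \<pi> p) = 0" by simp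
  with \<open>inj \<pi>\<close> show "p = 0"
    by (simp add: rename_qpoly_def qpoly_subst_comp eta_contract_eq)
qed (simp add: rename_qpoly_def)

definition rename_ratfun :: "(nat \<Rightarrow> nat) \<Rightarrow> ratfun \<Rightarrow> ratfun" where
  "rename_ratfun \<pi> = fract_map (rename_qpoly \<pi>)"

context
  fixes \<pi> :: "nat \<Rightarrow> nat"
  assumes inj: "inj \<pi>"
begin

lemma rename_Fract:
  "q \<noteq> 0 \<Longrightarrow> rename_ratfun \<pi> (Fract p q) = Fract (rename_qpoly \<pi> p) (rename_qpoly \<pi> q)"
  using rename_qpoly_eq_0_iff[OF inj, of q]
  unfolding rename_ratfun_def rename_qpoly_def by (simp add: fract_map_subst_Fract)

lemma rename_ratfun_0: "rename_ratfun \<pi> 0 = 0" and rename_ratfun_1: "rename_ratfun \<pi> 1 = 1"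
  unfolding Zero_fract_def One_fract_def by (simp_all add: rename_Fract rename_qpoly_def)

lemma rename_ratfun_add: "rename_ratfun \<pi> (f + g) = rename_ratfun \<pi> f + rename_ratfun \<pi> g"
proof -
  obtain p q p' q' where "f = Fract p q" "q \<noteq> 0" "g = Fract p' q'" "q' \<noteq> 0"
    by (metis Fract_cases)
  then show ?thesis
    using inj by (simp add: rename_Fract) (simp add: rename_qpoly_def qpoly_subst_add qpoly_subst_mult)
qed

lemma rename_ratfun_mult: "rename_ratfun \<pi> (f * g) = rename_ratfun \<pi> f * rename_ratfun \<pi> g"
proof -
  obtain p q p' q' where "f = Fract p q" "q \<noteq> 0" "g = Fract p' q'" "q' \<noteq> 0"
    by (metis Fract_cases)
  then show ?thesis
    using inj by (simp add: rename_Fract) (simp add: rename_qpoly_def qpoly_subst_mult)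
qed

lemma rename_ratfun_diff: "rename_ratfun \<pi> (f - g) = rename_ratfun \<pi> f - rename_ratfun \<pi> g"
  using rename_ratfun_add[of "f - g" g] by simp

lemma rename_ratfun_inverse: "rename_ratfun \<pi> (1 / f) = 1 / rename_ratfun \<pi> f"
proof (cases "f = 0")
  case False
  then have "rename_ratfun \<pi> f * rename_ratfun \<pi> (1 / f) = 1"
    by (simp add: rename_ratfun_1 flip: rename_ratfun_mult)
  then show ?thesis
    by (metis nonzero_eq_divide_eq mult.commute mult_zero_left zero_neq_one)
qed (simp add: rename_ratfun_0)

lemma rename_ratfun_divide: "rename_ratfun \<pi> (f / g) = rename_ratfun \<pi> f / rename_ratfun \<pi> g"
  using rename_ratfun_mult[of f "1 / g"] rename_ratfun_inverse[of g] by simp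

lemma rename_ratfun_const: "rename_ratfun \<pi> (Fract (qpoly_const c) 1) = Fract (qpoly_const c) 1"
  by (simp add: rename_Fract rename_qpoly_def)

lemma rename_ratfun_mem:
  assumes "f \<in> ratfuns m" "\<And>i. i < m \<Longrightarrow> \<pi> i < n"
  shows "rename_ratfun \<pi> f \<in> ratfuns n"
proof -
  obtain p q where pq: "f = Fract p q" "q \<noteq> 0" "qpoly_vars p \<subseteq> {..<m}" "qpoly_vars q \<subseteq> {..<m}"
    using assms(1) by (rule ratfunsE)
  have "qpoly_vars (rename_qpoly \<pi> r) \<subseteq> {..<n}" if "qpoly_vars r \<subseteq> {..<m}" for r
    unfolding rename_qpoly_def by (rule qpoly_vars_subst) (use that assms(2) in auto)
  then show ?thesis
    using pq inj by (simp add: rename_Fract ratfunsI)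
qed

end

lemma rename_ratfun_comp:
  "inj \<pi> \<Longrightarrow> inj \<rho> \<Longrightarrow> rename_ratfun \<pi> (rename_ratfun \<rho> f) = rename_ratfun (\<pi> \<circ> \<rho>) f"
  by (cases f) (simp add: rename_Fract inj_compose, simp add: rename_qpoly_def qpoly_subst_comp)

section \<open>Linear forms and the fields of rational functions in the first n variables\<close>

lemma lin_poly_superset:
  "finite S \<Longrightarrow> Poly_Mapping.keys w \<subseteq> S \<Longrightarrow>
    lin_poly w = (\<Sum>i\<in>S. qpoly_const (of_int (Poly_Mapping.lookup w i)) * qpoly_var i)"
  unfolding lin_poly_def by (rule sum.mono_neutral_left) (auto simp: in_keys_iff)

lemma lin_poly_diff: "lin_poly (v - w) = lin_poly v - lin_poly w"
proof -
  let ?S = "Poly_Mapping.keys v \<union> Poly_Mapping.keys w"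
  have "Poly_Mapping.keys (v - w) \<subseteq> ?S" by (rule keys_diff)
  moreover have "qpoly_const (a - b) = qpoly_const a - qpoly_const b" for a b
    by (simp add: qpoly_const_def single_diff)
  ultimately show ?thesis
    by (simp add: lin_poly_superset[of ?S] lookup_minus left_diff_distrib sum_subtractf)
qed

lemma lin_poly_var [simp]: "lin_poly (lin_var i) = qpoly_var i"
  by (simp add: lin_poly_def lin_var_def)

lemma qpoly_var_inject [simp]: "qpoly_var i = qpoly_var j \<longleftrightarrow> i = j"
  by (metis qpoly_vars_var singleton_inject)

abbreviation var :: "nat \<Rightarrow> ratfun" where
  "var i \<equiv> lin_ratfun (lin_var i)"

lemma lin_ratfun_diff: "lin_ratfun (v - w) = lin_ratfun v - lin_ratfun w"
  by (simp add: lin_ratfun_def lin_poly_diff)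

lemma inj_var: "inj var"
  by (rule injI) (simp add: lin_ratfun_def eq_fract)

lemma lin_var_inject [simp]: "lin_var i = lin_var j \<longleftrightarrow> i = j"
  using injD[OF inj_var] by metis

lemma rename_ratfun_var: "inj \<pi> \<Longrightarrow> rename_ratfun \<pi> (var i) = var (\<pi> i)"
  by (simp add: lin_ratfun_def rename_Fract rename_qpoly_def)

lemma ratfuns_var: "i < n \<Longrightarrow> var i \<in> ratfuns n"
  by (simp add: lin_ratfun_def ratfunsI)

lemma ratfuns_const: "Fract (qpoly_const c) 1 \<in> ratfuns n"
  by (simp add: ratfunsI)

lemma ratfuns_0: "0 \<in> ratfuns n"
  using ratfuns_const[of 0] by (simp add: fract_collapse)

lemma ratfuns_add:
  assumes "f \<in> ratfuns n" "g \<in> ratfuns n" shows "f + g \<in> ratfuns n"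
proof -
  obtain p q where "f = Fract p q" "q \<noteq> 0" "qpoly_vars p \<subseteq> {..<n}" "qpoly_vars q \<subseteq> {..<n}"
    using assms(1) by (rule ratfunsE)
  moreover obtain p' q' where "g = Fract p' q'" "q' \<noteq> 0" "qpoly_vars p' \<subseteq> {..<n}" "qpoly_vars q' \<subseteq> {..<n}"
    using assms(2) by (rule ratfunsE)
  ultimately show ?thesis
    by (simp, intro ratfunsI qpoly_vars_add qpoly_vars_mult) simp_all
qed

lemma ratfuns_mult:
  assumes "f \<in> ratfuns n" "g \<in> ratfuns n" shows "f * g \<in> ratfuns n"
proof -
  obtain p q where "f = Fract p q" "q \<noteq> 0" "qpoly_vars p \<subseteq> {..<n}" "qpoly_vars q \<subseteq> {..<n}"
    using assms(1) by (rule ratfunsE)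
  moreover obtain p' q' where "g = Fract p' q'" "q' \<noteq> 0" "qpoly_vars p' \<subseteq> {..<n}" "qpoly_vars q' \<subseteq> {..<n}"
    using assms(2) by (rule ratfunsE)
  ultimately show ?thesis
    by (simp, intro ratfunsI qpoly_vars_mult) simp_all
qed

lemma ratfuns_uminus: "f \<in> ratfuns n \<Longrightarrow> - f \<in> ratfuns n"
  by (erule ratfunsE) (simp add: ratfunsI)

lemma ratfuns_diff: "f \<in> ratfuns n \<Longrightarrow> g \<in> ratfuns n \<Longrightarrow> f - g \<in> ratfuns n"
  using ratfuns_add[of f n "- g"] ratfuns_uminus[of g n] by simp

lemma ratfuns_inverse:
  assumes "f \<in> ratfuns n" shows "1 / f \<in> ratfuns n"
proof -
  obtain p q where "f = Fract p q" "q \<noteq> 0" "qpoly_vars p \<subseteq> {..<n}" "qpoly_vars q \<subseteq> {..<n}"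
    using assms by (rule ratfunsE)
  then show ?thesis
    by (cases "p = 0") (simp_all add: fract_collapse ratfuns_0 ratfunsI flip: inverse_eq_divide)
qed

text \<open>Numerator and denominator can be chosen in the first m variables, where the substitution
  of the evaluation agrees with \<pi>. Evaluation at distinct variables is thus never
  degenerate.\<close>

lemma ratfun_eval_rename:
  assumes "inj \<pi>" "f \<in> ratfuns m"
  shows "ratfun_eval f (map (\<lambda>i. lin_var (\<pi> i)) [0..<m]) = rename_ratfun \<pi> f"
proof -
  let ?h = "\<lambda>i. if i < m then lin_poly (map (\<lambda>i. lin_var (\<pi> i)) [0..<m] ! i) else 0"
  obtain p q where pq: "f = Fract p q" "q \<noteq> 0" "qpoly_vars p \<subseteq> {..<m}" "qpoly_vars q \<subseteq> {..<m}"
    using assms(2) by (rule ratfunsE)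
  have *: "qpoly_subst ?h r = rename_qpoly \<pi> r" if "qpoly_vars r \<subseteq> {..<m}" for r
    unfolding rename_qpoly_def by (rule qpoly_subst_cong) (use that in auto)
  have "ratfun_eval f (map (\<lambda>i. lin_var (\<pi> i)) [0..<m]) = fract_map (qpoly_subst ?h) f"
    by (simp only: ratfun_eval_def fract_map_def Let_def length_map length_upt minus_nat.diff_0)
  also have "\<dots> = Fract (rename_qpoly \<pi> p) (rename_qpoly \<pi> q)"
    using pq assms(1) by (simp only: pq(1), subst fract_map_subst_Fract) (simp_all only: * rename_qpoly_eq_0_iff not_False_eq_True)
  finally show ?thesis
    using pq assms(1) by (simp add: rename_Fract)
qed

section \<open>The flexion map on functionals of words\<close>

lemma recip_diff_swap: "1 / (a - b) = - (1 / (b - a :: 'k::field))"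
  by (metis minus_diff_eq minus_divide_right)

text \<open>Letters carry the index of a variable and \<open>X\<close> supplies its value;
  injectivity of \<open>X\<close> makes the difference of two distinct variables invertible.\<close>

locale flexion_algebra = comm_monoid G for G :: "('g, 'b) monoid_scheme" (structure) +
  fixes X :: "nat \<Rightarrow> 'k::field"
  assumes inj_X: "inj X"
begin

definition words :: "nat set \<Rightarrow> ('g \<times> nat) list set" where
  "words S = {w. fst ` set w \<subseteq> carrier G \<and> snd ` set w \<subseteq> S \<and> distinct (map snd w)}"

text \<open>
  Elements of the span of words enter only through their values under functionals \<open>f\<close> on words, so
  a linear map of the span appears as the induced map on functionals. Below, \<open>flex f\<close> is \<open>f \<circ> \<phi>\<close>, where
  \<open>\<phi>(x z w) = x \<phi>(z w) + \<phi>((xz) w) / (z - x)\<close> and \<open>xz\<close> is \<open>absorb x z\<close>; \<open>unflex f\<close> is \<open>f \<circ> \<phi>\<^sup>-\<^sup>1\<close>, since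
  \<open>x \<phi>(z w) = \<phi>(x z w - (xz) w / (z - x))\<close>; \<open>shuffle_val f p q\<close> and \<open>stuffle_val f p q\<close> are the values of \<open>f\<close>
  at the two products of \<open>p\<close> and \<open>q\<close>.
\<close>

definition absorb :: "'g \<times> nat \<Rightarrow> 'g \<times> nat \<Rightarrow> 'g \<times> nat" where
  "absorb x z = (fst x \<otimes> fst z, snd x)"

fun flex :: "(('g \<times> nat) list \<Rightarrow> 'k) \<Rightarrow> ('g \<times> nat) list \<Rightarrow> 'k" where
  "flex f [] = f []"
| "flex f [x] = f [x]"
| "flex f (x # z # w) =
     flex (\<lambda>u. f (x # u)) (z # w) + 1 / (X (snd z) - X (snd x)) * flex f (absorb x z # w)"

definition peel :: "'g \<times> nat \<Rightarrow> (('g \<times> nat) list \<Rightarrow> 'k) \<Rightarrow> ('g \<times> nat) list \<Rightarrow> 'k" where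
  "peel x f u = (case u of [] \<Rightarrow> f [x]
     | z # u' \<Rightarrow> f (x # z # u') - 1 / (X (snd z) - X (snd x)) * f (absorb x z # u'))"

fun unflex :: "(('g \<times> nat) list \<Rightarrow> 'k) \<Rightarrow> ('g \<times> nat) list \<Rightarrow> 'k" where
  "unflex f [] = f []"
| "unflex f (x # w) = unflex (peel x f) w"

fun shuffle_val :: "(('g \<times> nat) list \<Rightarrow> 'k) \<Rightarrow> ('g \<times> nat) list \<Rightarrow> ('g \<times> nat) list \<Rightarrow> 'k" where
  "shuffle_val f [] q = f q"
| "shuffle_val f (x # p) [] = f (x # p)"
| "shuffle_val f (x # p) (y # q) = shuffle_val (\<lambda>u. f (x # u)) p (y # q) + shuffle_val (\<lambda>u. f (y # u)) (x # p) q"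

fun stuffle_val :: "(('g \<times> nat) list \<Rightarrow> 'k) \<Rightarrow> ('g \<times> nat) list \<Rightarrow> ('g \<times> nat) list \<Rightarrow> 'k" where
  "stuffle_val f [] q = f q"
| "stuffle_val f (x # p) [] = f (x # p)"
| "stuffle_val f (x # p) (y # q) = stuffle_val (\<lambda>u. f (x # u)) p (y # q) + stuffle_val (\<lambda>u. f (y # u)) (x # p) q
     + 1 / (X (snd x) - X (snd y)) *
       (stuffle_val (\<lambda>u. f (absorb x y # u)) p q - stuffle_val (\<lambda>u. f ((fst x \<otimes> fst y, snd y) # u)) p q)"

text \<open>The product of moulds on functionals, dual to deconcatenation. It recurses on the first
  letter in order to be compared with \<open>flex\<close>.\<close>

fun conv :: "(('g \<times> nat) list \<Rightarrow> 'k) \<Rightarrow> (('g \<times> nat) list \<Rightarrow> 'k) \<Rightarrow> ('g \<times> nat) list \<Rightarrow> 'k" where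
  "conv f g [] = f [] * g []"
| "conv f g (x # w) = f [] * g (x # w) + conv (\<lambda>u. f (x # u)) g w"

lemma snd_absorb [simp]: "snd (absorb x z) = snd x"
  by (simp add: absorb_def)

lemma fst_absorb [simp]: "fst (absorb x z) = fst x \<otimes> fst z"
  by (simp add: absorb_def)

lemma words_Nil [simp]: "[] \<in> words S"
  by (simp add: words_def)

lemma words_Diff [simp]: "w \<in> words (S - T) \<longleftrightarrow> w \<in> words S \<and> snd ` set w \<inter> T = {}"
  by (auto simp: words_def)

lemma words_Cons [simp]:
  "x # w \<in> words S \<longleftrightarrow> fst x \<in> carrier G \<and> snd x \<in> S \<and> snd x \<notin> snd ` set w \<and> w \<in> words S"
  by (auto simp: words_def)

lemma words_append [simp]:
  "p @ q \<in> words S \<longleftrightarrow> p \<in> words S \<and> q \<in> words S \<and> snd ` set p \<inter> snd ` set q = {}"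
  by (auto simp: words_def)

section \<open>Linearity, invertibility and multiplicativity of the dual flexion map\<close>

lemma conv_eq_sum: "conv f g w = (\<Sum>i\<le>length w. f (take i w) * g (drop i w))"
proof (induction w arbitrary: f)
  case (Cons x w)
  then show ?case
    by (simp add: sum.atMost_Suc_shift del: sum.atMost_Suc)
qed simp

lemma flex_linear: "flex (\<lambda>u. a * f u + b * g u) w = a * flex f w + b * flex g w"
proof (induction f w arbitrary: g rule: flex.induct)
  case (3 f x z w)
  show ?case
    by (simp only: flex.simps 3) (simp add: algebra_simps)
qed simp_all

lemma flex_add: "flex (\<lambda>u. f u + g u) w = flex f w + flex g w"
  using flex_linear[of 1 f 1 g] by simp

lemma flex_scale: "flex (\<lambda>u. a * f u) w = a * flex f w"
  using flex_linear[of a f 0 f] by simp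

text \<open>\<open>flex\<close> is a finite linear combination of values of its functional, so its
  applications in two separate words can be interchanged like finite sums.\<close>

lemma flex_commute: "flex (\<lambda>a. flex (\<lambda>b. F a b) q) p = flex (\<lambda>b. flex (\<lambda>a. F a b) p) q"
proof -
  have "flex (\<lambda>a. flex (F a) q) p = flex (\<lambda>b. flex (\<lambda>a. F a b) p) q"
  proof (induction "\<lambda>a. flex (F a) q" p arbitrary: F rule: flex.induct)
    case (3 x z w)
    have "flex (\<lambda>u. flex (F (x # u)) q) (z # w) = flex (\<lambda>b. flex (\<lambda>a. F (x # a) b) (z # w)) q"
      by (rule 3(1)[of "\<lambda>u. F (x # u)"]) simp
    with 3(2)[of F] show ?case
      by (simp only: flex.simps flex_add flex_scale)
  qed simp_all
  then show ?thesis by simp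
qed

text \<open>Peeling off x subtracts exactly the merged term that the recursion of
  \<open>flex\<close> adds. The weights cancel whatever their value, including the default 1 / 0 = 0
  at repeated variables.\<close>

lemma flex_unflex: "flex (unflex f) w = f w"
proof (induction "unflex f" w arbitrary: f rule: flex.induct)
  case (3 x z w)
  have "flex (unflex (peel x f)) (z # w) = peel x f (z # w)"
    by (rule 3(1)) simp
  with 3(2)[of f] show ?case
    by (simp add: peel_def)
qed (simp_all add: peel_def)

lemma unflex_flex: "unflex (flex f) w = f w"
proof (induction w arbitrary: f)
  case (Cons x w)
  have "peel x (flex f) = flex (\<lambda>u. f (x # u))"
    by (rule ext) (simp add: peel_def split: list.split)
  then show ?case by (simp add: Cons)
qed simp

lemma conv_linear:
  "conv (\<lambda>u. a * f u + b * f' u) g w = a * conv f g w + b * conv f' g w"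
  by (simp add: conv_eq_sum algebra_simps sum.distrib sum_distrib_left)

text \<open>Merging x with z keeps both on the same side of a cut, so the cut between x and z occurs
  only in the unmerged term. For every other cut the merged and unmerged terms recombine by the
  recursion of \<open>flex\<close> on the side that contains x and z.\<close>

lemma flex_conv: "flex (conv f g) w = conv (flex f) (flex g) w"
proof (induction "length w" arbitrary: w f g rule: less_induct)
  case less
  consider "w = []" | x where "w = [x]" | x z w' where "w = x # z # w'"
    by (meson remdups_adj.cases)
  then show ?case
  proof cases
    case 3
    define k where "k = 1 / (X (snd z) - X (snd x))"
    have 1: "flex (\<lambda>u. conv f g (x # u)) (z # w') = f [] * flex (\<lambda>u. g (x # u)) (z # w')
       + conv (flex (\<lambda>u. f (x # u))) (flex g) (z # w')"
      using less[of "z # w'" "\<lambda>u. f (x # u)" g] 3 by (simp only: conv.simps flex_add flex_scale) simp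
    have 2: "conv (\<lambda>u. flex f (x # z # u)) (flex g) w' = conv (\<lambda>u. flex (\<lambda>u. f (x # u)) (z # u)) (flex g) w'
      + k * conv (\<lambda>u. flex f (absorb x z # u)) (flex g) w'"
      using conv_linear[of 1 _ k] by (simp add: k_def)
    show ?thesis
      using 1 2 less[of "absorb x z # w'" f g] 3 by (simp add: algebra_simps flip: k_def)
  qed simp_all
qed

section \<open>The homomorphism from the quasi-shuffle to the shuffle product\<close>

lemma stuffle_val_linear: "stuffle_val (\<lambda>u. a * f u + b * g u) p q = a * stuffle_val f p q + b * stuffle_val g p q"
proof (induction f p q arbitrary: g rule: stuffle_val.induct)
  case (3 f x p y q)
  show ?case
    by (simp only: stuffle_val.simps 3) (simp add: algebra_simps)
qed simp_all

lemma stuffle_val_Nil2 [simp]: "stuffle_val f p [] = f p" and shuffle_val_Nil2 [simp]: "shuffle_val f p [] = f p"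
  by (cases p; simp)+

lemma shuffle_val_commute: "shuffle_val f p q = shuffle_val f q p"
  by (induction f p q rule: shuffle_val.induct) simp_all

text \<open>Exchanging the words changes the sign of the weight and of the difference of the merged
  terms; the merged labels agree by commutativity in the carrier.\<close>

lemma stuffle_val_commute: "p @ q \<in> words S \<Longrightarrow> stuffle_val f p q = stuffle_val f q p"
proof (induction f p q arbitrary: S rule: stuffle_val.induct)
  case (3 f x p y q)
  have mem: "fst x \<in> carrier G" "fst y \<in> carrier G"
    "p @ y # q \<in> words S" "(x # p) @ q \<in> words S" "p @ q \<in> words S"
    using "3.prems" by auto
  define k where "k = 1 / (X (snd x) - X (snd y))"
  have k: "1 / (X (snd x) - X (snd y)) = k" "1 / (X (snd y) - X (snd x)) = - k"
    by (simp_all add: k_def recip_diff_swap[of "X (snd y)" "X (snd x)"])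
  have "absorb x y = (fst y \<otimes> fst x, snd x)" "absorb y x = (fst x \<otimes> fst y, snd y)"
    using mem by (simp_all add: absorb_def m_comm)
  then show ?case
    using 3(1)[OF mem(3)] 3(2)[OF mem(4)] 3(3)[OF mem(5)] 3(4)[OF mem(5)]
    unfolding stuffle_val.simps k by (simp add: algebra_simps)
qed simp_all

text \<open>The left half-shuffle (dendriform product). With the value 0 at an empty first word, the
  shuffle is the sum of this half and its exchanged copy unless both words are empty.\<close>

fun left_shuffle_val :: "(('g \<times> nat) list \<Rightarrow> 'k) \<Rightarrow> ('g \<times> nat) list \<Rightarrow> ('g \<times> nat) list \<Rightarrow> 'k" where
  "left_shuffle_val f [] q = 0"
| "left_shuffle_val f (x # p) q = shuffle_val (\<lambda>u. f (x # u)) p q"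

text \<open>
  Shuffles starting with the letter contributed by \<open>x\<close> come from the terms of the quasi-shuffle
  starting with \<open>x\<close> itself or with \<open>xy\<close> at the position of \<open>x\<close>. Exchanging the two words gives the
  remaining terms, because \<open>1 / (x - y)\<close> is antisymmetric.
\<close>

lemma stuffle_val_flex_head:
  assumes IH: "\<And>f p' q' S. length p' + length q' < n \<Longrightarrow> p' @ q' \<in> words S \<Longrightarrow>
      stuffle_val (flex f) p' q' = flex (\<lambda>a. flex (\<lambda>b. shuffle_val f a b) q') p'"
    and "length (x # p) + length (y # q) \<le> n" "x # p @ y # q \<in> words S"
  shows "stuffle_val (\<lambda>u. flex f (x # u)) p (y # q)
      + 1 / (X (snd x) - X (snd y)) * stuffle_val (\<lambda>u. flex f (absorb x y # u)) p q
      = flex (\<lambda>a. flex (\<lambda>b. left_shuffle_val f a b) (y # q)) (x # p)"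
  using assms(2,3)
proof (induction p arbitrary: x S)
  case Nil
  have "left_shuffle_val f [x] = (\<lambda>u. f (x # u))"
    by (rule ext) simp
  then show ?case by (simp add: recip_diff_swap[of "X (snd x)"])
next
  case (Cons z p x)
  define kxz kxy kzy where "kxz = 1 / (X (snd z) - X (snd x))" and "kxy = 1 / (X (snd y) - X (snd x))"
    and "kzy = 1 / (X (snd z) - X (snd y))"
  have kxy': "1 / (X (snd x) - X (snd y)) = - kxy"
    by (simp add: kxy_def recip_diff_swap[of "X (snd x)"])
  have mem: "fst x \<in> carrier G" "fst y \<in> carrier G" "fst z \<in> carrier G"
    "snd x \<noteq> snd y" "snd x \<noteq> snd z" "snd y \<noteq> snd z"
    "(z # p) @ y # q \<in> words S" "absorb x z # p @ y # q \<in> words S"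
    using Cons.prems by auto
  have X: "X (snd x) \<noteq> X (snd y)" "X (snd x) \<noteq> X (snd z)" "X (snd y) \<noteq> X (snd z)"
    using mem by (auto dest: injD[OF inj_X])
  have eq1: "absorb x (absorb z y) = absorb (absorb x z) y"
    "absorb x (fst z \<otimes> fst y, snd y) = absorb (absorb x z) y"
    "absorb (absorb x y) z = absorb (absorb x z) y"
    using mem by (simp_all add: absorb_def m_ac)
  \<comment> \<open>The merger of z and y occurs at the variable of z and at that of y. Absorbed
    into x, both give the same letter, and only this difference of weights remains.\<close>
  have k: "kzy * (kxz - kxy) = - (kxz * kxy)"
    using X by (simp add: kxz_def kxy_def kzy_def divide_simps)
  have st: "stuffle_val (\<lambda>u. flex (\<lambda>v. f (c # v)) (d # u) + k * flex f (e # u)) p' q' =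
     stuffle_val (\<lambda>u. flex (\<lambda>v. f (c # v)) (d # u)) p' q' + k * stuffle_val (\<lambda>u. flex f (e # u)) p' q'"
    for c d e k p' q'
    using stuffle_val_linear[of 1 _ k] by simp
  let ?f = "\<lambda>u. f (x # u)"
  \<comment> \<open>Every term of the quasi-shuffle starts with z, with y or with their merger, so
    the recursion of \<open>flex\<close> applies to x and that letter. The term with factor
    \<open>kxy\<close> cancels the second summand of the claim.\<close>
  have A: "stuffle_val (\<lambda>u. flex f (x # u)) (z # p) (y # q) = stuffle_val (flex ?f) (z # p) (y # q)
      + kxz * stuffle_val (\<lambda>u. flex f (absorb x z # u)) p (y # q)
      + kxy * stuffle_val (\<lambda>u. flex f (absorb x y # u)) (z # p) q
      + kzy * (kxz - kxy) * stuffle_val (\<lambda>u. flex f (absorb (absorb x z) y # u)) p q"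
    by (simp add: st eq1 flip: kxz_def kxy_def kzy_def) (simp add: algebra_simps)
  have B: "stuffle_val (flex ?f) (z # p) (y # q) = flex (\<lambda>a. flex (\<lambda>b. shuffle_val ?f a b) (y # q)) (z # p)"
    by (rule IH[OF _ mem(7)]) (use Cons.prems in simp)
  \<comment> \<open>The induction hypothesis for leading letter xz, which still sits at the variable
    of x; its weight against y is again \<open>- kxy\<close>.\<close>
  have C: "stuffle_val (\<lambda>u. flex f (absorb x z # u)) p (y # q)
      - kxy * stuffle_val (\<lambda>u. flex f (absorb (absorb x z) y # u)) p q
      = flex (\<lambda>a. flex (\<lambda>b. left_shuffle_val f a b) (y # q)) (absorb x z # p)"
    using Cons.IH[OF _ mem(8)] Cons.prems by (simp add: kxy')
  show ?case
    unfolding A B kxy' k flex.simps(3)[of _ x z] left_shuffle_val.simps C[symmetric] kxz_def[symmetric]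
    by (simp add: algebra_simps)
qed

section \<open>Relations between values that the recursions preserve\<close>

abbreviation rename :: "(nat \<Rightarrow> nat) \<Rightarrow> ('g \<times> nat) list \<Rightarrow> ('g \<times> nat) list" where
  "rename \<pi> \<equiv> map (apsnd \<pi>)"

lemma absorb_apsnd: "absorb (apsnd \<pi> x) (apsnd \<pi> z) = apsnd \<pi> (absorb x z)"
  by (simp add: absorb_def apsnd_def map_prod_def split: prod.split)

text \<open>The operations build their values by sums, differences and weights at distinct
  variables. One closure argument thus gives congruence (R is equality), equivariance (R is the
  graph of a renaming) and control of the variables (R is membership in \<open>ratfuns n\<close>); V
  bounds the indices for the last purpose.\<close>

context
  fixes R :: "'k \<Rightarrow> 'k \<Rightarrow> bool" and \<pi> :: "nat \<Rightarrow> nat" and V :: "nat set"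
  assumes R_add: "\<And>a a' b b'. R a a' \<Longrightarrow> R b b' \<Longrightarrow> R (a + b) (a' + b')"
    and R_diff: "\<And>a a' b b'. R a a' \<Longrightarrow> R b b' \<Longrightarrow> R (a - b) (a' - b')"
    and R_weight: "\<And>a a' i j. R a a' \<Longrightarrow> i \<in> V \<Longrightarrow> j \<in> V \<Longrightarrow> i \<noteq> j \<Longrightarrow>
      R (1 / (X i - X j) * a) (1 / (X (\<pi> i) - X (\<pi> j)) * a')"
begin

text \<open>A nonempty word leads only to nonempty words, which matters because the symmetry
  conditions speak of nonempty words. S loses the variable of x in the call with u -> f(x u), so
  that x u keeps distinct variables.\<close>

lemma flex_transfer:
  "w \<in> words S \<Longrightarrow> S \<subseteq> V \<Longrightarrow>
    (\<And>u. u \<in> words S \<Longrightarrow> u = [] \<longleftrightarrow> w = [] \<Longrightarrow> R (f u) (g (rename \<pi> u))) \<Longrightarrow>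
    R (flex f w) (flex g (rename \<pi> w))"
proof (induction f w arbitrary: g S rule: flex.induct)
  case (3 f x z w)
  have mem: "z # w \<in> words (S - {snd x})" "absorb x z # w \<in> words S"
    "snd x \<in> V" "snd z \<in> V" "snd z \<noteq> snd x"
    using "3.prems"(1,2) by auto
  have 1: "R (flex (\<lambda>u. f (x # u)) (z # w)) (flex (\<lambda>u. g (apsnd \<pi> x # u)) (rename \<pi> (z # w)))"
    by (rule 3(1)[OF mem(1)]) (use "3.prems"(1,2) "3.prems"(3)[of "x # _"] in auto)
  have 2: "R (flex f (absorb x z # w)) (flex g (rename \<pi> (absorb x z # w)))"
    by (rule 3(2)[OF mem(2) "3.prems"(2)]) (simp add: "3.prems"(3))
  show ?case
    using R_add[OF 1 R_weight[OF 2 mem(4,3,5)]] by (simp add: absorb_apsnd)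
next
  case (1 f)
  from "1.prems"(3)[of "[]"] "1.prems"(1) show ?case by simp
next
  case (2 f x)
  from "2.prems"(3)[of "[x]"] "2.prems"(1) show ?case by simp
qed

lemma unflex_transfer:
  "w \<in> words S \<Longrightarrow> S \<subseteq> V \<Longrightarrow> 
    (\<And>u. u \<in> words S \<Longrightarrow> u = [] \<longleftrightarrow> w = [] \<Longrightarrow> R (f u) (g (rename \<pi> u))) \<Longrightarrow>
    R (unflex f w) (unflex g (rename \<pi> w))"
proof (induction w arbitrary: f g S)
  case (Cons x w)
  have "R (unflex (peel x f) w) (unflex (peel (apsnd \<pi> x) g) (rename \<pi> w))"
  proof (rule Cons.IH)
    show "w \<in> words (S - {snd x})" "S - {snd x} \<subseteq> V"
      using Cons.prems by auto
    fix u assume u: "u \<in> words (S - {snd x})"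
    show "R (peel x f u) (peel (apsnd \<pi> x) g (rename \<pi> u))"
    proof (cases u)
      case Nil
      then show ?thesis
        using Cons.prems(3)[of "[x]"] Cons.prems(1) by (simp add: peel_def)
    next
      case (Cons z u')
      have "x # z # u' \<in> words S" "absorb x z # u' \<in> words S" "snd x \<in> V" "snd z \<in> V" "snd z \<noteq> snd x"
        using Cons.prems u Cons by auto
      then show ?thesis
        using R_diff[OF Cons.prems(3) R_weight[OF Cons.prems(3)], of "x # z # u'" "absorb x z # u'" "snd z" "snd x"]
        by (simp add: peel_def Cons absorb_apsnd)
    qed
  qed
  then show ?case by simp
next
  case Nil
  from Nil(3)[of "[]"] show ?case by simp
qed

lemma shuffle_val_transfer:
  "p @ q \<in> words S \<Longrightarrow> (\<And>u. u \<in> words S \<Longrightarrow> R (f u) (g (rename \<pi> u))) \<Longrightarrow>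
    R (shuffle_val f p q) (shuffle_val g (rename \<pi> p) (rename \<pi> q))"
proof (induction f p q arbitrary: g S rule: shuffle_val.induct)
  case (3 f x p y q)
  have mem: "p @ y # q \<in> words (S - {snd x})" "(x # p) @ q \<in> words (S - {snd y})"
    "fst x \<in> carrier G" "snd x \<in> S" "fst y \<in> carrier G" "snd y \<in> S"
    using "3.prems"(1) by auto
  have 1: "R (shuffle_val (\<lambda>u. f (x # u)) p (y # q))
      (shuffle_val (\<lambda>u. g (apsnd \<pi> x # u)) (rename \<pi> p) (rename \<pi> (y # q)))"
    by (rule 3(1)[OF mem(1)]) (use "3.prems"(2)[of "x # _"] mem in simp)
  have 2: "R (shuffle_val (\<lambda>u. f (y # u)) (x # p) q)
      (shuffle_val (\<lambda>u. g (apsnd \<pi> y # u)) (rename \<pi> (x # p)) (rename \<pi> q))"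
    by (rule 3(2)[OF mem(2)]) (use "3.prems"(2)[of "y # _"] mem in simp)
  show ?case
    using R_add[OF 1 2] by simp
next
  case (1 f q)
  from "1.prems"(2)[of "q"] "1.prems"(1) show ?case by simp
next
  case (2 f x p)
  from "2.prems"(2)[of "x # p"] "2.prems"(1) show ?case by simp
qed

lemma stuffle_val_transfer:
  "p @ q \<in> words S \<Longrightarrow> S \<subseteq> V \<Longrightarrow> (\<And>u. u \<in> words S \<Longrightarrow> R (f u) (g (rename \<pi> u))) \<Longrightarrow>
    R (stuffle_val f p q) (stuffle_val g (rename \<pi> p) (rename \<pi> q))"
proof (induction f p q arbitrary: g S rule: stuffle_val.induct)
  case (3 f x p y q)
  let ?yx = "(fst x \<otimes> fst y, snd y)"
  have mem: "p @ y # q \<in> words (S - {snd x})" "(x # p) @ q \<in> words (S - {snd y})"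
    "fst x \<in> carrier G" "snd x \<in> S" "fst y \<in> carrier G" "snd y \<in> S" "snd x \<noteq> snd y"
    "p @ q \<in> words (S - {snd x})" "p @ q \<in> words (S - {snd y})"
    using "3.prems"(1) by auto
  have V: "S - {snd x} \<subseteq> V" "S - {snd y} \<subseteq> V" "snd x \<in> V" "snd y \<in> V"
    using "3.prems"(2) mem by auto
  have 1: "R (stuffle_val (\<lambda>u. f (x # u)) p (y # q))
      (stuffle_val (\<lambda>u. g (apsnd \<pi> x # u)) (rename \<pi> p) (rename \<pi> (y # q)))"
    by (rule 3(1)[OF mem(1) V(1)]) (use "3.prems"(3)[of "x # _"] mem in simp)
  have 2: "R (stuffle_val (\<lambda>u. f (y # u)) (x # p) q)
      (stuffle_val (\<lambda>u. g (apsnd \<pi> y # u)) (rename \<pi> (x # p)) (rename \<pi> q))"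
    by (rule 3(2)[OF mem(2) V(2)]) (use "3.prems"(3)[of "y # _"] mem in simp)
  have h: "R (stuffle_val (\<lambda>u. f (absorb x y # u)) p q)
      (stuffle_val (\<lambda>u. g (apsnd \<pi> (absorb x y) # u)) (rename \<pi> p) (rename \<pi> q))"
    by (rule 3(3)[OF mem(8) V(1)]) (use "3.prems"(3)[of "absorb x y # _"] mem in simp)
  have 4: "R (stuffle_val (\<lambda>u. f (?yx # u)) p q)
      (stuffle_val (\<lambda>u. g (apsnd \<pi> ?yx # u)) (rename \<pi> p) (rename \<pi> q))"
    by (rule 3(4)[OF mem(9) V(2)]) (use "3.prems"(3)[of "?yx # _"] mem in simp)
  show ?case
    using R_add[OF R_add[OF 1 2] R_weight[OF R_diff[OF h 4] V(3,4) mem(7)]]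
    by (simp add: absorb_apsnd)
next
  case (1 f q)
  from "1.prems"(3)[of "q"] "1.prems"(1) show ?case by simp
next
  case (2 f x p)
  from "2.prems"(3)[of "x # p"] "2.prems"(1) show ?case by simp
qed

end

lemma rename_id [simp]: "rename (\<lambda>i. i) w = w"
  by (simp add: apsnd_def map_prod_def)

lemma flex_cong:
  assumes "w \<in> words S" "\<And>u. u \<in> words S \<Longrightarrow> u = [] \<longleftrightarrow> w = [] \<Longrightarrow> f u = g u"
  shows "flex f w = flex g w"
  using flex_transfer[of "(=)" UNIV "\<lambda>i. i" w S f g] assms by simp

lemma unflex_cong:
  assumes "w \<in> words S" "\<And>u. u \<in> words S \<Longrightarrow> u = [] \<longleftrightarrow> w = [] \<Longrightarrow> f u = g u"
  shows "unflex f w = unflex g w"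
  using unflex_transfer[of "(=)" UNIV "\<lambda>i. i" w S f g] assms by simp

lemma shuffle_val_cong:
  assumes "p @ q \<in> words S" "\<And>u. u \<in> words S \<Longrightarrow> f u = g u"
  shows "shuffle_val f p q = shuffle_val g p q"
  using shuffle_val_transfer[of "(=)" UNIV "\<lambda>i. i" p q S f g] assms by simp

lemma stuffle_val_cong:
  assumes "p @ q \<in> words S" "\<And>u. u \<in> words S \<Longrightarrow> f u = g u"
  shows "stuffle_val f p q = stuffle_val g p q"
  using stuffle_val_transfer[of "(=)" UNIV "\<lambda>i. i" p q S f g] assms by simp

text \<open>The half of the shuffles led by the first word is \<open>stuffle_val_flex_head\<close>;
  the other half is the same statement with the words exchanged, brought back by commutativity of
  the quasi-shuffle and \<open>flex_commute\<close>.\<close>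

lemma stuffle_val_flex:
  "p @ q \<in> words S \<Longrightarrow> stuffle_val (flex f) p q = flex (\<lambda>a. flex (\<lambda>b. shuffle_val f a b) q) p"
proof (induction "length p + length q" arbitrary: p q f S rule: less_induct)
  case less
  have [simp]: "shuffle_val f [] = f"
    by (rule ext) simp
  consider "p = []" | "q = []" | x p' y q' where "p = x # p'" "q = y # q'"
    by (meson list.exhaust)
  then show ?case
  proof cases
    case 3
    have mem: "x # p' @ y # q' \<in> words S" "y # q' @ x # p' \<in> words S"
      "fst x \<in> carrier G" "fst y \<in> carrier G" "(x # p') @ q' \<in> words S" "p' @ q' \<in> words S"
      "p \<in> words S"
      using less.prems unfolding 3 by auto
    have eq: "absorb y x = (fst x \<otimes> fst y, snd y)"
      using mem by (simp add: absorb_def m_comm)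
    have L: "stuffle_val (\<lambda>u. flex f (x # u)) p' (y # q')
        + 1 / (X (snd x) - X (snd y)) * stuffle_val (\<lambda>u. flex f (absorb x y # u)) p' q'
        = flex (\<lambda>a. flex (\<lambda>b. left_shuffle_val f a b) q) p"
      unfolding 3 by (rule stuffle_val_flex_head[OF less.hyps _ mem(1)]) (auto simp: 3)
    have "stuffle_val (\<lambda>u. flex f (y # u)) q' (x # p')
        + 1 / (X (snd y) - X (snd x)) * stuffle_val (\<lambda>u. flex f (absorb y x # u)) q' p'
        = flex (\<lambda>a. flex (\<lambda>b. left_shuffle_val f a b) p) q"
      unfolding 3 by (rule stuffle_val_flex_head[OF less.hyps _ mem(2)]) (auto simp: 3)
    then have R: "stuffle_val (\<lambda>u. flex f (y # u)) (x # p') q'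
        - 1 / (X (snd x) - X (snd y)) * stuffle_val (\<lambda>u. flex f ((fst x \<otimes> fst y, snd y) # u)) p' q'
        = flex (\<lambda>a. flex (\<lambda>b. left_shuffle_val f b a) q) p"
      unfolding eq stuffle_val_commute[OF mem(5)] stuffle_val_commute[OF mem(6)] 
       flex_commute[of "\<lambda>a b. left_shuffle_val f a b"]
      by (simp add: recip_diff_swap[of "X (snd y)"] algebra_simps)
    have "flex (\<lambda>a. flex (\<lambda>b. shuffle_val f a b) q) p
      = flex (\<lambda>a. flex (\<lambda>b. left_shuffle_val f a b + left_shuffle_val f b a) q) p"
    \<comment> \<open>As \<open>p\<close> is nonempty, so is every \<open>a\<close> that occurs, and
      the decomposition into half-shuffles is valid for all \<open>b\<close>.\<close>
    proof (rule flex_cong[OF mem(7)])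
      fix a :: "('g \<times> nat) list" assume "a = [] \<longleftrightarrow> p = []"
      then have "shuffle_val f a b = left_shuffle_val f a b + left_shuffle_val f b a" for b
        using 3 by (cases a; cases b) (auto intro: shuffle_val_commute)
      then have "shuffle_val f a = (\<lambda>b. left_shuffle_val f a b + left_shuffle_val f b a)" ..
      then show "flex (shuffle_val f a) q = flex (\<lambda>b. left_shuffle_val f a b + left_shuffle_val f b a) q"
        by simp
    qed
    then show ?thesis
      unfolding flex_add L[symmetric] R[symmetric] unfolding 3 stuffle_val.simps
      by (simp add: algebra_simps)
  qed simp_all
qed
end

section \<open>Factorizations of words\<close>

text \<open>The expected value of \<open>pic\<close> at \<open>flexion_low a b\<close>. With this
  explicit product the recursion over factorizations holds for all words; distinct variables enter
  only in the comparison with \<open>pic\<close>.\<close>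

definition block_weight :: "'g word \<Rightarrow> 'g word \<Rightarrow> ratfun" where
  "block_weight a b = (\<Prod>(\<rho>, v)\<leftarrow>b. 1 / lin_ratfun (v - snd (last a)))"

definition factorization_term :: "('g, 'b) monoid_scheme \<Rightarrow> ('g word \<Rightarrow> ratfun) \<Rightarrow> ('g word \<times> 'g word) list \<Rightarrow> ratfun" where
  "factorization_term \<Gamma> F fs = (\<Prod>(a, b)\<leftarrow>fs. block_weight a b) *
     F (concat (map (\<lambda>(a, b). flexion_up \<Gamma> a b) fs))"

lemma factorizations_Cons:
  "(a, b) # r \<in> factorizations w \<longleftrightarrow> a \<noteq> [] \<and>
    (r = [] \<and> w = a @ b \<or> r \<noteq> [] \<and> b \<noteq> [] \<and> (\<exists>w'. w = a @ b @ w' \<and> r \<in> factorizations w'))"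
  unfolding factorizations_def by (cases "r = []") auto

lemma Nil_notin_factorizations [simp]: "[] \<notin> factorizations w"
  by (simp add: factorizations_def)

lemma factorizations_single: "factorizations [x] = {[([x], [])]}"
proof (rule Set.set_eqI)
  fix fs show "fs \<in> factorizations [x] \<longleftrightarrow> fs \<in> {[([x], [])]}"
    by (cases fs) (auto simp: factorizations_Cons Cons_eq_append_conv)
qed

text \<open>
  A factorization of \<open>x z w\<close> with \<open>a\<^sub>1 \<noteq> x\<close> arises from one of \<open>z w\<close> by prepending \<open>x\<close> to \<open>a\<^sub>1\<close>; one with
  \<open>a\<^sub>1 = x\<close> from one of \<open>(xz) w\<close> by splitting the first letter into \<open>x\<close> and \<open>z\<close>. This matches the
  recursion of \<open>flex\<close>.
\<close>

fun prepend_block :: "'g letter \<Rightarrow> ('g word \<times> 'g word) list \<Rightarrow> ('g word \<times> 'g word) list" where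
  "prepend_block x [] = []"
| "prepend_block x ((a, b) # r) = (x # a, b) # r"

fun split_block :: "'g letter \<Rightarrow> 'g letter \<Rightarrow> ('g word \<times> 'g word) list \<Rightarrow> ('g word \<times> 'g word) list" where
  "split_block x z [] = []"
| "split_block x z ((a, b) # r) = (if tl a = [] then ([x], z # b) # r else ([x], [z]) # (tl a, b) # r)"

text \<open>\<open>split_block\<close> discards the first letter of the first a, so \<open>y\<close>
  is a mere placeholder: it becomes the merged letter xz in the sum and z in the finiteness
  proof.\<close>

lemma factorizations_Cons_Cons:
  "factorizations (x # z # w) =
    prepend_block x ` factorizations (z # w) \<union> split_block x z ` factorizations (y # w)"
proof (intro equalityI subsetI)
  fix fs assume fs: "fs \<in> factorizations (x # z # w)"
  then obtain a b r where [simp]: "fs = (a, b) # r" by (cases fs) auto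
  from fs obtain a' where a: "a = x # a'"
    by (auto simp: factorizations_Cons Cons_eq_append_conv)
  show "fs \<in> prepend_block x ` factorizations (z # w) \<union> split_block x z ` factorizations (y # w)"
  proof (cases "a' = []")
    case False
    then have "(a', b) # r \<in> factorizations (z # w)"
      using fs a by (auto simp: factorizations_Cons)
    then show ?thesis
      using a by (auto intro!: image_eqI[of _ _ "(a', b) # r"])
  next
    case True
    then obtain b' where b: "b = z # b'"
      using fs a by (auto simp: factorizations_Cons Cons_eq_append_conv)
    show ?thesis
    \<comment> \<open>If the pair ([x], [z]) is followed by others, removing z would leave an empty
      b before the last pair. The placeholder is then attached to the next a instead.\<close>
    proof (cases "b' = [] \<and> r \<noteq> []")
      case True
      then obtain a2 b2 r2 where r: "r = (a2, b2) # r2" by (cases r) auto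
      have "(y # a2, b2) # r2 \<in> factorizations (y # w)" "a2 \<noteq> []"
        using fs a b r True \<open>a' = []\<close> by (auto simp: factorizations_Cons)
      then show ?thesis
        using a b r True \<open>a' = []\<close> by (auto intro!: image_eqI[of _ _ "(y # a2, b2) # r2"])
    next
      case False
      then have "([y], b') # r \<in> factorizations (y # w)"
        using fs a b \<open>a' = []\<close> by (auto simp: factorizations_Cons)
      then show ?thesis
        using a b \<open>a' = []\<close> by (auto intro!: image_eqI[of _ _ "([y], b') # r"])
    qed
  qed
next
  fix fs assume "fs \<in> prepend_block x ` factorizations (z # w) \<union> split_block x z ` factorizations (y # w)"
  then consider fs' where "fs' \<in> factorizations (z # w)" "fs = prepend_block x fs'"
    | fs' where "fs' \<in> factorizations (y # w)" "fs = split_block x z fs'"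
    by blast
  then show "fs \<in> factorizations (x # z # w)"
  proof cases
    case 1
    then show ?thesis by (cases fs') (auto simp: factorizations_Cons)
  next
    case 2
    then obtain a b r where fs': "fs' = (a, b) # r" by (cases fs') auto
    with 2 obtain a' where a: "a = y # a'"
      by (auto simp: factorizations_Cons Cons_eq_append_conv)
    show ?thesis
    proof (cases "a' = []")
      case True
      then show ?thesis using 2 fs' a by (auto simp: factorizations_Cons)
    next
      case False
      then show ?thesis using 2 fs' a by (auto simp: factorizations_Cons)
    qed
  qed
qed

lemma inj_prepend_block: "inj_on (prepend_block x) (factorizations w)"
proof (rule inj_onI)
  fix r s assume "r \<in> factorizations w" "s \<in> factorizations w" "prepend_block x r = prepend_block x s"
  then show "r = s" by (cases r; cases s) auto
qed

lemma inj_split_block: "inj_on (split_block x z) (factorizations (y # w))"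
proof (rule inj_onI)
  fix r s assume *: "r \<in> factorizations (y # w)" "s \<in> factorizations (y # w)" "split_block x z r = split_block x z s"
  obtain a b r' where r: "r = (a, b) # r'" using * by (cases r) auto
  obtain c d s' where s: "s = (c, d) # s'" using * by (cases s) auto
  obtain a' c' where a: "a = y # a'" "c = y # c'"
    using * r s by (auto simp: factorizations_Cons Cons_eq_append_conv)
  \<comment> \<open>The two cases of \<open>split_block\<close> could give equal lists only if ([y],
    []) were followed by another pair, and an empty b is allowed only at the end.\<close>
  have "a' = [] \<Longrightarrow> r' \<noteq> [] \<Longrightarrow> b \<noteq> []" "c' = [] \<Longrightarrow> s' \<noteq> [] \<Longrightarrow> d \<noteq> []"
    using * r s by (auto simp: factorizations_Cons)
  then show "r = s"
    using *(3) unfolding r s a by (auto split: if_splits)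
qed

lemma prepend_split_disjoint:
  "prepend_block x ` factorizations v \<inter> split_block x' z ` factorizations w = {}"
proof -
  have "prepend_block x r \<noteq> split_block x' z s" if "r \<in> factorizations v" "s \<in> factorizations w" for r s
    using that by (cases r; cases s) (auto simp: factorizations_Cons split: if_splits)
  then show ?thesis by blast
qed

lemma finite_factorizations: "w \<noteq> [] \<Longrightarrow> finite (factorizations w)"
proof (induction "length w" arbitrary: w rule: less_induct)
  case less
  then consider x where "w = [x]" | x z w' where "w = x # z # w'"
    by (metis remdups_adj.cases)
  then show ?case
  proof cases
    case (2 x z w')
    then show ?thesis
      using less.hyps[of "z # w'"] by (simp add: factorizations_Cons_Cons[of x z w' z])
  qed (simp add: factorizations_single)
qed

definition factorization_sum :: "('g, 'b) monoid_scheme \<Rightarrow> ('g word \<Rightarrow> ratfun) \<Rightarrow> 'g word \<Rightarrow> ratfun" where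
  "factorization_sum \<Gamma> F w = (\<Sum>fs\<in>factorizations w. factorization_term \<Gamma> F fs)"

lemma factorization_sum_single: "factorization_sum \<Gamma> F [x] = F [x]"
  by (simp add: factorization_sum_def factorizations_single factorization_term_def block_weight_def flexion_up_def)

text \<open>Weights refer to the last letter of a, so prepending x does not affect them. Splitting
  xz contributes exactly the weight of z against x and leaves the flexed word unchanged.\<close>

lemma factorization_sum_Cons_Cons:
  fixes \<Gamma> :: "('g, 'b) monoid_scheme"
  shows "factorization_sum \<Gamma> F (x # z # w) = factorization_sum \<Gamma> (\<lambda>u. F (x # u)) (z # w)
    + 1 / lin_ratfun (snd z - snd x) * factorization_sum \<Gamma> F ((fst x \<otimes>\<^bsub>\<Gamma>\<^esub> fst z, snd x) # w)"
proof -
  let ?y = "(fst x \<otimes>\<^bsub>\<Gamma>\<^esub> fst z, snd x)" and ?k = "1 / lin_ratfun (snd z - snd x)"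
  have pre: "factorization_term \<Gamma> F (prepend_block x fs) = factorization_term \<Gamma> (\<lambda>u. F (x # u)) fs"
    if mem: "fs \<in> factorizations (z # w)" for fs
  proof -
    obtain a b r where "fs = (a, b) # r" "a \<noteq> []"
      using mem by (cases fs) (auto simp: factorizations_Cons)
    then show ?thesis
      by (simp add: factorization_term_def block_weight_def flexion_up_def)
  qed
  have split: "factorization_term \<Gamma> F (split_block x z fs) = ?k * factorization_term \<Gamma> F fs"
    if mem: "fs \<in> factorizations (?y # w)" for fs
  proof -
    obtain a b r where "fs = (?y # a, b) # r"
      using mem by (cases fs) (auto simp: factorizations_Cons Cons_eq_append_conv)
    then show ?thesis
      by (cases "a = []") (simp_all add: factorization_term_def block_weight_def flexion_up_def case_prod_beta mult_ac)
  qed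
  show ?thesis
    unfolding factorization_sum_def factorizations_Cons_Cons[of x z w ?y]
    by (simp add: sum.union_disjoint finite_factorizations prepend_split_disjoint sum.reindex
        inj_prepend_block inj_split_block pre split sum_distrib_left comp_def)
qed

section \<open>Evaluation of pic at linear forms\<close>

lemma lin_ratfun_prod: "(\<Prod>i\<in>A. lin_ratfun (g i)) = Fract (\<Prod>i\<in>A. lin_poly (g i)) 1"
  by (induction A rule: infinite_finite_induct) (simp_all add: lin_ratfun_def One_fract_def)

lemma pic_at:
  assumes "fst ` set \<alpha> \<subseteq> carrier \<Gamma>" "\<And>v. v \<in> snd ` set \<alpha> \<Longrightarrow> lin_poly v \<noteq> 0"
  shows "mould_at (pic \<Gamma>) \<alpha> = (\<Prod>(\<rho>, v)\<leftarrow>\<alpha>. 1 / lin_ratfun v)"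
proof -
  let ?n = "length \<alpha>" and ?v = "\<lambda>i. snd (\<alpha> ! i)"
  let ?h = "\<lambda>i. if i < ?n then lin_poly (map snd \<alpha> ! i) else 0"
  have "map fst \<alpha> \<in> lists (carrier \<Gamma>)"
    using assms(1) by (auto simp: in_lists_conv_set)
  then have "pic \<Gamma> (map fst \<alpha>) = 1 / (\<Prod>i<?n. lin_ratfun (lin_var i))"
    by (simp add: pic_def)
  also have "\<dots> = Fract 1 (\<Prod>i<?n. qpoly_var i)"
    unfolding lin_ratfun_prod by (simp add: inverse_eq_divide[symmetric])
  finally have pic: "pic \<Gamma> (map fst \<alpha>) = Fract 1 (\<Prod>i<?n. qpoly_var i)" .
  have h: "qpoly_subst ?h (\<Prod>i<?n. qpoly_var i) = (\<Prod>i<?n. lin_poly (?v i))"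
    by (simp add: qpoly_subst_prod)
  have "(\<Prod>i<?n. lin_poly (?v i)) \<noteq> 0"
    using assms(2) by simp
  then have "fract_map (qpoly_subst ?h) (Fract 1 (\<Prod>i<?n. qpoly_var i)) = Fract 1 (\<Prod>i<?n. lin_poly (?v i))"
    using fract_map_subst_Fract[of ?h "\<Prod>i<?n. qpoly_var i" 1] unfolding h by simp
  then have "mould_at (pic \<Gamma>) \<alpha> = Fract 1 (\<Prod>i<?n. lin_poly (?v i))"
    by (simp only: mould_at_def pic ratfun_eval_def fract_map_def Let_def length_map)
  also have "\<dots> = 1 / (\<Prod>i<?n. lin_ratfun (?v i))"
    unfolding lin_ratfun_prod by (simp add: inverse_eq_divide[symmetric])
  also have "\<dots> = (\<Prod>i<?n. 1 / lin_ratfun (?v i))"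
    by (simp add: prod_dividef)
  also have "\<dots> = (\<Prod>(\<rho>, v)\<leftarrow>\<alpha>. 1 / lin_ratfun v)"
    by (simp add: prod.list_conv_set_nth case_prod_beta atLeast0LessThan)
  finally show ?thesis .
qed

section \<open>Moulds as natural functionals\<close>

lemma rename_ratfun_id [simp]: "rename_ratfun (\<lambda>i. i) f = f"
  by (cases f) (simp add: rename_Fract rename_qpoly_def)

lemma rename_ratfun_sum:
  "inj \<pi> \<Longrightarrow> rename_ratfun \<pi> (\<Sum>i\<in>A. f i) = (\<Sum>i\<in>A. rename_ratfun \<pi> (f i))"
  by (induction A rule: infinite_finite_induct) (simp_all add: rename_ratfun_0 rename_ratfun_add)

lemma ratfuns_sum: "(\<And>i. i \<in> A \<Longrightarrow> f i \<in> ratfuns n) \<Longrightarrow> (\<Sum>i\<in>A. f i) \<in> ratfuns n"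
  by (induction A rule: infinite_finite_induct) (simp_all add: ratfuns_0 ratfuns_add)

lemma map_snd_apsnd: "map snd (map (apsnd f) w) = map f (map snd w)"
  by simp

lemma distinct_map_snd_apsnd: "inj f \<Longrightarrow> distinct (map snd w) \<Longrightarrow> distinct (map snd (map (apsnd f) w))"
  unfolding map_snd_apsnd distinct_map[of f] by (simp add: inj_on_subset[OF _ subset_UNIV])

lemma distinct_eq_map_inj:
  assumes "distinct (is :: nat list)"
  obtains \<pi> where "inj \<pi>" "is = map \<pi> [0..<length is]"
proof
  \<comment> \<open>Beyond the list the values are pushed past its maximum, making \<pi> injective
    on all indices, as the renaming of rational functions demands.\<close>
  define \<pi> where "\<pi> i = (if i < length is then is ! i else Suc (i + Max (set is)))" for i
  have less: "is ! i < Suc (j + Max (set is))" if "i < length is" for i j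
    using that by (simp add: less_Suc_eq_le trans_le_add2)
  show "inj \<pi>"
  proof (rule injI)
    fix i j assume eq: "\<pi> i = \<pi> j"
    show "i = j"
    proof (cases "i < length is"; cases "j < length is")
      assume "i < length is" "j < length is"
      then show ?thesis using eq assms by (simp add: \<pi>_def nth_eq_iff_index_eq)
    next
      assume "i < length is" "\<not> j < length is"
      then show ?thesis using eq less[of i j] by (simp add: \<pi>_def)
    next
      assume "\<not> i < length is" "j < length is"
      then show ?thesis using eq less[of j i] by (simp add: \<pi>_def)
    qed (use eq in \<open>simp add: \<pi>_def\<close>)
  qed
  show "is = map \<pi> [0..<length is]"
    by (rule nth_equalityI) (simp_all add: \<pi>_def)
qed

section \<open>Words in distinct variables as renamings of standard words\<close>

abbreviation embed :: "('g \<times> nat) list \<Rightarrow> 'g word" where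
  "embed \<equiv> map (apsnd lin_var)"

definition mould_val :: "'g mould \<Rightarrow> ('g \<times> nat) list \<Rightarrow> ratfun" where
  "mould_val A w = mould_at A (embed w)"

definition std_word :: "nat \<Rightarrow> 'g list \<Rightarrow> ('g \<times> nat) list" where
  "std_word k \<sigma>s = zip \<sigma>s [k..<k + length \<sigma>s]"

lemma embed_std_word: "embed (std_word k \<sigma>s) = var_word k \<sigma>s"
  by (simp add: std_word_def var_word_def zip_map2 apsnd_def map_prod_def)

lemma length_std_word [simp]: "length (std_word k \<sigma>s) = length \<sigma>s"
  by (simp add: std_word_def)

lemma map_fst_std_word [simp]: "map fst (std_word k \<sigma>s) = \<sigma>s"
  by (simp add: std_word_def)

lemma map_snd_std_word [simp]: "map snd (std_word k \<sigma>s) = [k..<k + length \<sigma>s]"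
  by (simp add: std_word_def)

lemma std_word_append: "std_word k (\<sigma>s @ \<tau>s) = std_word k \<sigma>s @ std_word (k + length \<sigma>s) \<tau>s"
  by (simp add: std_word_def zip_append1 add.assoc upt_add_eq_append[of k "k + length \<sigma>s"])

lemma eq_rename_std_word:
  assumes "map snd w = map \<pi> [0..<length w]"
  shows "w = map (apsnd \<pi>) (std_word 0 (map fst w))"
proof -
  have "w = zip (map fst w) (map snd w)" by (simp add: zip_map_fst_snd)
  also have "\<dots> = map (apsnd \<pi>) (std_word 0 (map fst w))"
    unfolding assms by (simp add: std_word_def zip_map2 apsnd_def map_prod_def)
  finally show ?thesis .
qed

section \<open>Functionals evaluated on the span of words\<close>

definition span_eval :: "('g word \<Rightarrow> ratfun) \<Rightarrow> ('g word \<Rightarrow>\<^sub>0 ratfun) \<Rightarrow> ratfun" where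
  "span_eval f P = (\<Sum>\<alpha>\<in>Poly_Mapping.keys P. Poly_Mapping.lookup P \<alpha> * f \<alpha>)"

lemma span_eval_superset:
  "finite S \<Longrightarrow> Poly_Mapping.keys P \<subseteq> S \<Longrightarrow> span_eval f P = (\<Sum>\<alpha>\<in>S. Poly_Mapping.lookup P \<alpha> * f \<alpha>)"
  unfolding span_eval_def by (rule sum.mono_neutral_left) (auto simp: in_keys_iff)

lemma span_eval_add: "span_eval f (P + Q) = span_eval f P + span_eval f Q"
proof -
  let ?S = "Poly_Mapping.keys P \<union> Poly_Mapping.keys Q"
  have "Poly_Mapping.keys (P + Q) \<subseteq> ?S" by (rule keys_add)
  then show ?thesis
    by (simp add: span_eval_superset[of ?S] lookup_add distrib_right sum.distrib)
qed

lemma span_eval_diff: "span_eval f (P - Q) = span_eval f P - span_eval f Q"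
  using span_eval_add[of f "P - Q" Q] by simp

lemma span_eval_single: "span_eval f (Poly_Mapping.single \<alpha> c) = c * f \<alpha>"
  by (simp add: span_eval_superset[of "{\<alpha>}"])

lemma span_eval_0: "span_eval f 0 = 0"
  by (simp add: span_eval_def)

lemma span_eval_sum: "span_eval f (\<Sum>i\<in>A. P i) = (\<Sum>i\<in>A. span_eval f (P i))"
  by (induction A rule: infinite_finite_induct) (simp_all add: span_eval_0 span_eval_add)

lemma span_eval_Cons: "span_eval f (span_Cons x P) = span_eval (\<lambda>u. f (x # u)) P"
  unfolding span_Cons_def span_eval_sum span_eval_single by (simp add: span_eval_def)

lemma span_eval_smult: "span_eval f (span_smult c P) = c * span_eval f P"
proof -
  have lk: "Poly_Mapping.lookup (span_smult c P) \<alpha> = c * Poly_Mapping.lookup P \<alpha>" for \<alpha>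
    by (simp add: span_smult_def Poly_Mapping.map.rep_eq when_def)
  then have "Poly_Mapping.keys (span_smult c P) \<subseteq> Poly_Mapping.keys P"
    by (auto simp: in_keys_iff)
  then show ?thesis
    by (simp add: span_eval_superset[of "Poly_Mapping.keys P"] lk sum_distrib_left mult.assoc)
qed

lemma mould_sum_eq_span_eval: "mould_sum A P = span_eval (mould_at A) P"
  by (simp add: mould_sum_def span_eval_def)

section \<open>The correspondence between moulds and natural functionals\<close>

locale mould_space = comm_group \<Gamma> for \<Gamma> :: "('g, 'b) monoid_scheme" (structure)
begin

sublocale flexion_algebra \<Gamma> var
  by unfold_locales (rule inj_var)

lemma factorization_sum_embed:
  "w \<noteq> [] \<Longrightarrow> factorization_sum \<Gamma> F (embed w) = flex (\<lambda>u. F (embed u)) w"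
proof (induction "length w" arbitrary: w F rule: less_induct)
  case less
  then consider x where "w = [x]" | x z w' where "w = x # z # w'"
    by (metis remdups_adj.cases)
  then show ?case
  proof cases
    case 1
    then show ?thesis by (simp add: factorization_sum_single)
  next
    case (2 x z w')
    have 1: "factorization_sum \<Gamma> (\<lambda>u. F (apsnd lin_var x # u)) (embed (z # w'))
        = flex (\<lambda>u. F (apsnd lin_var x # embed u)) (z # w')"
      by (rule less.hyps) (simp_all add: 2)
    have "factorization_sum \<Gamma> F (embed (absorb x z # w')) = flex (\<lambda>u. F (embed u)) (absorb x z # w')"
      by (rule less.hyps) (simp_all add: 2)
    moreover have "embed (absorb x z # w') = (fst x \<otimes> fst z, lin_var (snd x)) # embed w'"
      by (simp add: absorb_def)
    ultimately show ?thesis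
      using 1 by (simp add: 2 factorization_sum_Cons_Cons lin_ratfun_diff)
  qed
qed

text \<open>Since the variables of \<open>w\<close> are distinct, those of b differ from that of the
  last letter of a. Their differences are nonzero linear forms, so \<open>pic\<close> has a
  nonvanishing denominator there.\<close>

lemma block_weight_eq_pic:
  assumes w: "w \<in> words S" and "fs \<in> factorizations (embed w)" "(a, b) \<in> set fs"
  shows "mould_at (pic \<Gamma>) (flexion_low a b) = block_weight a b"
proof -
  obtain xs ys where "fs = xs @ (a, b) # ys"
    using assms(3) by (meson split_list)
  with assms(2) have "embed w = concat (map (\<lambda>(a, b). a @ b) xs) @ a @ b @ concat (map (\<lambda>(a, b). a @ b) ys)"
    by (simp add: factorizations_def)
  then obtain u v where uv: "embed w = u @ a @ b @ v" ..
  have "a \<noteq> []"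
    using assms(2,3) by (auto simp: factorizations_def)
  have "distinct (map snd (embed w))"
    using w by (intro distinct_map_snd_apsnd) (simp_all add: words_def inj_def)
  then have neq: "y \<noteq> snd (last a)" if "y \<in> snd ` set b" for y
    using that last_in_set[OF \<open>a \<noteq> []\<close>] unfolding uv by auto
  have "snd ` set (embed w) \<subseteq> range lin_var" by auto
  then have lin: "snd ` set b \<subseteq> range lin_var" "snd (last a) \<in> range lin_var"
    using last_in_set[OF \<open>a \<noteq> []\<close>] unfolding uv by auto
  have "lin_poly v \<noteq> 0" if v: "v \<in> snd ` set (flexion_low a b)" for v
  proof -
    obtain y where y: "y \<in> snd ` set b" "v = y - snd (last a)"
      using v by (force simp: flexion_low_def)
    moreover obtain i j where "y = lin_var i" "snd (last a) = lin_var j" using lin y(1) by blast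
    ultimately show ?thesis using neq[OF y(1)] by (auto simp: lin_poly_diff)
  qed
  moreover have "fst ` set (embed w) \<subseteq> carrier \<Gamma>"
    using w by (auto simp: words_def)
  then have "fst ` set (flexion_low a b) \<subseteq> carrier \<Gamma>"
    unfolding uv by (force simp: flexion_low_def)
  ultimately have "mould_at (pic \<Gamma>) (flexion_low a b) = (\<Prod>(\<rho>, v)\<leftarrow>flexion_low a b. 1 / lin_ratfun v)"
    by (intro pic_at)
  then show ?thesis
    by (simp add: block_weight_def flexion_low_def comp_def split_def)
qed

lemma std_word_in_words [simp]: "\<sigma>s \<in> lists (carrier \<Gamma>) \<Longrightarrow> std_word k \<sigma>s \<in> words UNIV"
  by (auto simp: words_def simp flip: set_map)

lemma std_word_in_words_lessThan: "\<sigma>s \<in> lists (carrier \<Gamma>) \<Longrightarrow> std_word 0 \<sigma>s \<in> words {..<length \<sigma>s}"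
  by (auto simp: words_def simp flip: set_map)

definition mould_of :: "(('g \<times> nat) list \<Rightarrow> ratfun) \<Rightarrow> 'g mould" where
  "mould_of F = (\<lambda>\<sigma>s\<in>lists (carrier \<Gamma>). F (std_word 0 \<sigma>s))"

text \<open>
  The functionals \<open>mould_val A\<close> of moulds \<open>A\<close> are exactly, on words with distinct variables, the
  functionals equivariant under renaming of variables whose values involve only the variables of the word.
\<close>

definition natural :: "(('g \<times> nat) list \<Rightarrow> ratfun) \<Rightarrow> bool" where
  "natural F \<longleftrightarrow>
    (\<forall>\<pi>. inj \<pi> \<longrightarrow> (\<forall>w\<in>words UNIV. F (rename \<pi> w) = rename_ratfun \<pi> (F w))) \<and>
    (\<forall>n. \<forall>w\<in>words {..<n}. F w \<in> ratfuns n)"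

lemma naturalD:
  assumes "natural F"
  shows "inj \<pi> \<Longrightarrow> w \<in> words UNIV \<Longrightarrow> F (rename \<pi> w) = rename_ratfun \<pi> (F w)"
    and "w \<in> words {..<n} \<Longrightarrow> F w \<in> ratfuns n"
  using assms by (auto simp: natural_def)

lemma wordsE:
  assumes "w \<in> words S"
  obtains \<pi> where "inj \<pi>" "map snd w = map \<pi> [0..<length w]" "w = rename \<pi> (std_word 0 (map fst w))"
proof -
  have "distinct (map snd w)" using assms by (simp add: words_def)
  then obtain \<pi> where "inj \<pi>" "map snd w = map \<pi> [0..<length w]"
    by (rule distinct_eq_map_inj) simp
  then show thesis using that eq_rename_std_word by blast
qed

lemma map_fst_words: "w \<in> words S \<Longrightarrow> map fst w \<in> lists (carrier \<Gamma>)"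
  by (auto simp: words_def)

lemma BIMU_D: "A \<in> BIMU \<Gamma> \<Longrightarrow> \<sigma>s \<in> lists (carrier \<Gamma>) \<Longrightarrow> A \<sigma>s \<in> ratfuns (length \<sigma>s)"
  unfolding BIMU_def by (auto dest: PiE_mem)

lemma mould_val_eq_rename:
  assumes "A \<in> BIMU \<Gamma>" "w \<in> words S" "inj \<pi>" "map snd w = map \<pi> [0..<length w]"
  shows "mould_val A w = rename_ratfun \<pi> (A (map fst w))"
proof -
  have "map (snd \<circ> apsnd lin_var) w = map lin_var (map snd w)"
    by simp
  then have "mould_val A w = ratfun_eval (A (map fst w)) (map (\<lambda>i. lin_var (\<pi> i)) [0..<length w])"
    using assms(4) by (simp add: mould_val_def mould_at_def comp_def)
  also have "\<dots> = rename_ratfun \<pi> (A (map fst w))"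
    using BIMU_D[OF assms(1) map_fst_words[OF assms(2)]] by (intro ratfun_eval_rename assms(3)) simp
  finally show ?thesis .
qed

lemma rename_in_words:
  assumes "w \<in> words UNIV" "inj \<pi>"
  shows "rename \<pi> w \<in> words UNIV"
proof -
  have "distinct (map snd (rename \<pi> w))"
    using assms by (intro distinct_map_snd_apsnd) (simp_all add: words_def)
  then show ?thesis
    using assms(1) by (simp add: words_def image_image)
qed

lemma natural_mould_val:
  assumes A: "A \<in> BIMU \<Gamma>"
  shows "natural (mould_val A)"
  unfolding natural_def
proof (intro conjI allI impI ballI)
  fix \<pi> :: "nat \<Rightarrow> nat" and w :: "('g \<times> nat) list" assume \<pi>: "inj \<pi>" and w: "w \<in> words UNIV"
  from w obtain \<rho> where \<rho>: "inj \<rho>" "map snd w = map \<rho> [0..<length w]"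
    by (rule wordsE)
  have "rename \<pi> w \<in> words UNIV"
    using w \<pi> by (rule rename_in_words)
  moreover have "map snd (rename \<pi> w) = map (\<pi> \<circ> \<rho>) [0..<length (rename \<pi> w)]"
    unfolding map_snd_apsnd \<rho>(2) by simp
  moreover have "map fst (rename \<pi> w) = map fst w"
    by (simp add: comp_def)
  ultimately have "mould_val A (rename \<pi> w) = rename_ratfun (\<pi> \<circ> \<rho>) (A (map fst w))"
    using mould_val_eq_rename[OF A] inj_compose[OF \<pi> \<rho>(1)] by metis
  then show "mould_val A (rename \<pi> w) = rename_ratfun \<pi> (mould_val A w)"
    using \<pi> \<rho> mould_val_eq_rename[OF A w \<rho>] by (simp add: rename_ratfun_comp)
next
  fix n :: nat and w :: "('g \<times> nat) list" assume w: "w \<in> words {..<n}"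
  from w obtain \<rho> where \<rho>: "inj \<rho>" "map snd w = map \<rho> [0..<length w]"
    by (rule wordsE)
  have "\<rho> i < n" if "i < length w" for i
  proof -
    have "\<rho> i = map snd w ! i" using \<rho>(2) that by simp
    then have "\<rho> i \<in> snd ` set w" using that by simp
    then show ?thesis using w by (auto simp: words_def)
  qed
  then show "mould_val A w \<in> ratfuns n"
    unfolding mould_val_eq_rename[OF A w \<rho>]
    using BIMU_D[OF A map_fst_words[OF w]] by (intro rename_ratfun_mem[OF \<rho>(1)]) auto
qed

lemma mould_val_std_word:
  assumes "A \<in> BIMU \<Gamma>" "\<sigma>s \<in> lists (carrier \<Gamma>)"
  shows "mould_val A (std_word 0 \<sigma>s) = A \<sigma>s"
proof -
  have "mould_val A (std_word 0 \<sigma>s) = rename_ratfun (\<lambda>i. i) (A (map fst (std_word 0 \<sigma>s)))"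
    by (rule mould_val_eq_rename[OF assms(1) std_word_in_words[OF assms(2)]]) simp_all
  then show ?thesis by simp
qed

lemma mould_val_Nil: "A \<in> BIMU \<Gamma> \<Longrightarrow> mould_val A [] = A []"
  using mould_val_std_word[of A "[]"] by (simp add: std_word_def)

lemma mould_of_mould_val:
  assumes "A \<in> BIMU \<Gamma>"
  shows "mould_of (mould_val A) = A"
proof
  fix \<sigma>s show "mould_of (mould_val A) \<sigma>s = A \<sigma>s"
  proof (cases "\<sigma>s \<in> lists (carrier \<Gamma>)")
    case True
    then show ?thesis using assms by (simp add: mould_of_def mould_val_std_word)
  next
    case False
    then show ?thesis using assms unfolding mould_of_def BIMU_def by (auto dest: PiE_arb)
  qed
qed

lemma mould_of_in_BIMU: "natural F \<Longrightarrow> mould_of F \<in> BIMU \<Gamma>"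
  unfolding BIMU_def mould_of_def by (auto intro!: naturalD(2) std_word_in_words_lessThan)

text \<open>\<open>mould_of\<close> retains only the values at standard words; equivariance recovers
  F at every word with distinct variables, each being a renamed standard word.\<close>

lemma mould_val_mould_of:
  assumes "natural F" "w \<in> words S"
  shows "mould_val (mould_of F) w = F w"
proof -
  obtain \<pi> where \<pi>: "inj \<pi>" "map snd w = map \<pi> [0..<length w]" "w = rename \<pi> (std_word 0 (map fst w))"
    using assms(2) by (rule wordsE)
  note lists = map_fst_words[OF assms(2)]
  have "mould_val (mould_of F) w = rename_ratfun \<pi> (mould_of F (map fst w))"
    using mould_val_eq_rename[OF mould_of_in_BIMU assms(2) \<pi>(1,2)] assms(1) .
  also have "\<dots> = rename_ratfun \<pi> (F (std_word 0 (map fst w)))"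
    using lists by (simp add: mould_of_def)
  also have "\<dots> = F (rename \<pi> (std_word 0 (map fst w)))"
    by (rule naturalD(1)[symmetric, OF assms(1) \<pi>(1) std_word_in_words[OF lists]])
  finally show ?thesis using \<pi>(3) by simp
qed

lemma mould_of_cong:
  "(\<And>w. w \<in> words UNIV \<Longrightarrow> F w = F' w) \<Longrightarrow> mould_of F = mould_of F'"
  unfolding mould_of_def by (rule restrict_ext) simp

lemma natural_flex:
  assumes "natural f"
  shows "natural (flex f)"
  unfolding natural_def
proof (intro conjI allI impI ballI)
  fix \<pi> :: "nat \<Rightarrow> nat" and w :: "('g \<times> nat) list" assume \<pi>: "inj \<pi>" and w: "w \<in> words UNIV"
  show "flex f (rename \<pi> w) = rename_ratfun \<pi> (flex f w)"
    by (rule flex_transfer[where R = "\<lambda>a b. b = rename_ratfun \<pi> a" and V = UNIV, OF _ _ _ w])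
      (simp_all add: \<pi> rename_ratfun_add rename_ratfun_diff rename_ratfun_mult
        rename_ratfun_divide rename_ratfun_var naturalD(1)[OF assms])
next
  fix n :: nat and w :: "('g \<times> nat) list" assume w: "w \<in> words {..<n}"
  show "flex f w \<in> ratfuns n"
    by (rule flex_transfer[where R = "\<lambda>a b. a \<in> ratfuns n" and V = "{..<n}" and \<pi> = "\<lambda>i. i", OF _ _ _ w])
      (simp_all add: ratfuns_add ratfuns_diff ratfuns_mult ratfuns_inverse ratfuns_var
        naturalD(2)[OF assms] del: times_divide_eq_left)
qed

lemma natural_unflex:
  assumes "natural f"
  shows "natural (unflex f)"
  unfolding natural_def
proof (intro conjI allI impI ballI)
  fix \<pi> :: "nat \<Rightarrow> nat" and w :: "('g \<times> nat) list" assume \<pi>: "inj \<pi>" and w: "w \<in> words UNIV"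
  show "unflex f (rename \<pi> w) = rename_ratfun \<pi> (unflex f w)"
    by (rule unflex_transfer[where R = "\<lambda>a b. b = rename_ratfun \<pi> a" and V = UNIV, OF _ _ _ w])
      (simp_all add: \<pi> rename_ratfun_add rename_ratfun_diff rename_ratfun_mult
        rename_ratfun_divide rename_ratfun_var naturalD(1)[OF assms])
next
  fix n :: nat and w :: "('g \<times> nat) list" assume w: "w \<in> words {..<n}"
  show "unflex f w \<in> ratfuns n"
    by (rule unflex_transfer[where R = "\<lambda>a b. a \<in> ratfuns n" and V = "{..<n}" and \<pi> = "\<lambda>i. i", OF _ _ _ w])
      (simp_all add: ratfuns_add ratfuns_diff ratfuns_mult ratfuns_inverse ratfuns_var
        naturalD(2)[OF assms] del: times_divide_eq_left)
qed

lemma shuffle_val_rename: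
  assumes "natural f" "inj \<pi>" "p @ q \<in> words UNIV"
  shows "shuffle_val f (rename \<pi> p) (rename \<pi> q) = rename_ratfun \<pi> (shuffle_val f p q)"
  by (rule shuffle_val_transfer[where R = "\<lambda>a b. b = rename_ratfun \<pi> a" and V = UNIV, OF _ _ _ assms(3)])
    (simp_all add: assms(2) rename_ratfun_add rename_ratfun_diff rename_ratfun_mult
      rename_ratfun_divide rename_ratfun_var naturalD(1)[OF assms(1)])

lemma stuffle_val_rename:
  assumes "natural f" "inj \<pi>" "p @ q \<in> words UNIV"
  shows "stuffle_val f (rename \<pi> p) (rename \<pi> q) = rename_ratfun \<pi> (stuffle_val f p q)"
  by (rule stuffle_val_transfer[where R = "\<lambda>a b. b = rename_ratfun \<pi> a" and V = UNIV, OF _ _ _ assms(3)])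
    (simp_all add: assms(2) rename_ratfun_add rename_ratfun_diff rename_ratfun_mult
      rename_ratfun_divide rename_ratfun_var naturalD(1)[OF assms(1)])

lemma words_take: "w \<in> words S \<Longrightarrow> take i w \<in> words S"
  and words_drop: "w \<in> words S \<Longrightarrow> drop i w \<in> words S"
  using words_append[of "take i w" "drop i w" S] by simp_all

lemma natural_conv:
  assumes "natural f" "natural g"
  shows "natural (conv f g)"
  unfolding natural_def conv_eq_sum
  by (simp add: take_map drop_map naturalD[OF assms(1)] naturalD[OF assms(2)] words_take words_drop
      rename_ratfun_sum rename_ratfun_mult ratfuns_sum ratfuns_mult)

lemma natural_add: "natural f \<Longrightarrow> natural g \<Longrightarrow> natural (\<lambda>w. f w + g w)"
  by (simp add: natural_def rename_ratfun_add ratfuns_add)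

lemma natural_diff: "natural f \<Longrightarrow> natural g \<Longrightarrow> natural (\<lambda>w. f w - g w)"
  by (simp add: natural_def rename_ratfun_diff ratfuns_diff)

lemma natural_smult: "natural f \<Longrightarrow> natural (\<lambda>w. Fract (qpoly_const c) 1 * f w)"
  by (simp add: natural_def rename_ratfun_mult rename_ratfun_const ratfuns_mult ratfuns_const)

lemma conv_cong:
  assumes "w \<in> words S" "\<And>u. u \<in> words S \<Longrightarrow> f u = f' u" "\<And>u. u \<in> words S \<Longrightarrow> g u = g' u"
  shows "conv f g w = conv f' g' w"
  unfolding conv_eq_sum using assms by (simp add: words_take words_drop)

section \<open>The map ganit and the algebra operations on functionals\<close>

lemma ganit_eq:
  assumes "A \<in> BIMU \<Gamma>"
  shows "ganit \<Gamma> (pic \<Gamma>) A = mould_of (flex (mould_val A))"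
  unfolding ganit_def mould_of_def
proof (rule restrict_ext)
  fix \<sigma>s assume \<sigma>s: "\<sigma>s \<in> lists (carrier \<Gamma>)"
  let ?w = "std_word 0 \<sigma>s"
  show "(if \<sigma>s = [] then A [] else \<Sum>fs\<in>factorizations (var_word 0 \<sigma>s).
      (\<Prod>(a, b)\<leftarrow>fs. mould_at (pic \<Gamma>) (flexion_low a b))
      * mould_at A (concat (map (\<lambda>(a, b). flexion_up \<Gamma> a b) fs))) = flex (mould_val A) ?w"
  proof (cases "\<sigma>s = []")
    case True
    then show ?thesis using assms by (simp add: std_word_def mould_val_Nil)
  next
    case False
    have weight: "(\<Prod>(a, b)\<leftarrow>fs. mould_at (pic \<Gamma>) (flexion_low a b)) = (\<Prod>(a, b)\<leftarrow>fs. block_weight a b)"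
      if "fs \<in> factorizations (embed ?w)" for fs
      by (rule arg_cong[where f = prod_list], rule map_cong[OF refl])
        (use block_weight_eq_pic[OF std_word_in_words[OF \<sigma>s] that] in auto)
    have "?w \<noteq> []"
      using False by (simp add: std_word_def)
    then have "factorization_sum \<Gamma> (mould_at A) (embed ?w) = flex (mould_val A) ?w"
      unfolding mould_val_def by (rule factorization_sum_embed)
    then show ?thesis
      using False by (simp add: factorization_sum_def factorization_term_def weight flip: embed_std_word)
  qed
qed

lemma ganit_mould_of:
  assumes "natural f"
  shows "ganit \<Gamma> (pic \<Gamma>) (mould_of f) = mould_of (flex f)"
  unfolding ganit_eq[OF mould_of_in_BIMU[OF assms]]
  by (intro mould_of_cong flex_cong[where S = UNIV] mould_val_mould_of[OF assms])

lemma mould_mult_mould_of: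
  assumes "natural f" "natural g"
  shows "mould_mult \<Gamma> (mould_of f) (mould_of g) = mould_of (conv f g)"
proof -
  have "mould_mult \<Gamma> A B = mould_of (conv (mould_val A) (mould_val B))" for A B
    unfolding mould_mult_def mould_of_def conv_eq_sum
    by (simp add: mould_val_def take_map drop_map flip: embed_std_word)
  then have "mould_mult \<Gamma> (mould_of f) (mould_of g) = mould_of (conv (mould_val (mould_of f)) (mould_val (mould_of g)))" .
  also have "\<dots> = mould_of (conv f g)"
    by (intro mould_of_cong conv_cong[where S = UNIV] mould_val_mould_of[OF assms(1)] mould_val_mould_of[OF assms(2)])
  finally show ?thesis .
qed

lemma mould_add_mould_of: "mould_add \<Gamma> (mould_of f) (mould_of g) = mould_of (\<lambda>w. f w + g w)"
  unfolding mould_add_def mould_of_def by (rule restrict_ext) simp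

lemma mould_smult_mould_of:
  "mould_smult \<Gamma> c (mould_of f) = mould_of (\<lambda>w. Fract (qpoly_const c) 1 * f w)"
  unfolding mould_smult_def mould_of_def by (rule restrict_ext) simp

lemma mould_bracket_mould_of:
  assumes "natural f" "natural g"
  shows "mould_bracket \<Gamma> (mould_of f) (mould_of g) = mould_of (\<lambda>w. conv f g w - conv g f w)"
  unfolding mould_bracket_def mould_mult_mould_of[OF assms] mould_mult_mould_of[OF assms(2,1)]
  unfolding mould_of_def by (rule restrict_ext) simp

lemma BIMU_E:
  assumes "A \<in> BIMU \<Gamma>"
  obtains f where "natural f" "A = mould_of f"
  using natural_mould_val[OF assms] mould_of_mould_val[OF assms] by metis

lemma ganit_mult:
  assumes "A \<in> BIMU \<Gamma>" "B \<in> BIMU \<Gamma>"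
  shows "ganit \<Gamma> (pic \<Gamma>) (mould_mult \<Gamma> A B)
    = mould_mult \<Gamma> (ganit \<Gamma> (pic \<Gamma>) A) (ganit \<Gamma> (pic \<Gamma>) B)"
proof -
  obtain f g where "natural f" "A = mould_of f" "natural g" "B = mould_of g"
    using assms BIMU_E by metis
  then show ?thesis
    by (simp add: mould_mult_mould_of ganit_mould_of natural_conv natural_flex)
      (rule mould_of_cong, rule flex_conv)
qed

lemma ganit_bracket:
  assumes "A \<in> BIMU \<Gamma>" "B \<in> BIMU \<Gamma>"
  shows "ganit \<Gamma> (pic \<Gamma>) (mould_bracket \<Gamma> A B)
    = mould_bracket \<Gamma> (ganit \<Gamma> (pic \<Gamma>) A) (ganit \<Gamma> (pic \<Gamma>) B)"
proof -
  have flex_diff: "flex (\<lambda>u. f u - g u) w = flex f w - flex g w" for f g w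
    using flex_linear[of 1 f "- 1" g w] by simp
  obtain f g where "natural f" "A = mould_of f" "natural g" "B = mould_of g"
    using assms BIMU_E by metis
  then show ?thesis
    by (simp add: mould_bracket_mould_of ganit_mould_of natural_conv natural_diff natural_flex)
      (rule mould_of_cong, simp add: flex_diff flex_conv)
qed

lemma ganit_add:
  assumes "A \<in> BIMU \<Gamma>" "B \<in> BIMU \<Gamma>"
  shows "ganit \<Gamma> (pic \<Gamma>) (mould_add \<Gamma> A B)
    = mould_add \<Gamma> (ganit \<Gamma> (pic \<Gamma>) A) (ganit \<Gamma> (pic \<Gamma>) B)"
proof -
  obtain f g where "natural f" "A = mould_of f" "natural g" "B = mould_of g"
    using assms BIMU_E by metis
  then show ?thesis
    by (simp add: mould_add_mould_of ganit_mould_of natural_add)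
      (rule mould_of_cong, rule flex_add)
qed

lemma ganit_smult:
  assumes "A \<in> BIMU \<Gamma>"
  shows "ganit \<Gamma> (pic \<Gamma>) (mould_smult \<Gamma> c A) = mould_smult \<Gamma> c (ganit \<Gamma> (pic \<Gamma>) A)"
proof -
  obtain f where "natural f" "A = mould_of f"
    using assms by (rule BIMU_E)
  then show ?thesis
    by (simp add: mould_smult_mould_of ganit_mould_of natural_smult)
      (rule mould_of_cong, rule flex_scale)
qed

section \<open>The symmetry types as conditions on functionals\<close>

lemma span_eval_shuffle: "span_eval f (shuffle (embed p) (embed q)) = shuffle_val (\<lambda>u. f (embed u)) p q"
proof (induction "length p + length q" arbitrary: f p q rule: less_induct)
  case less
  consider "p = []" | "q = []" | x p' y q' where "p = x # p'" "q = y # q'"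
    by (meson list.exhaust)
  then show ?case
  proof cases
    case 2
    then show ?thesis by (cases p) (simp_all add: span_eval_single)
  next
    case 3
    then show ?thesis
      using less[of p' q "\<lambda>u. f (apsnd lin_var x # u)"] less[of p q' "\<lambda>u. f (apsnd lin_var y # u)"]
      by (simp add: span_eval_add span_eval_Cons)
  qed (simp add: span_eval_single)
qed

text \<open>Distinct variables keep the recursion away from the default value 0 of the
  quasi-shuffle, a case that \<open>stuffle_val\<close> does not have.\<close>

lemma span_eval_stuffle:
  "p @ q \<in> words S \<Longrightarrow> span_eval f (stuffle \<Gamma> (embed p) (embed q)) = stuffle_val (\<lambda>u. f (embed u)) p q"
proof (induction "length p + length q" arbitrary: f p q rule: less_induct)
  case less
  consider "p = []" | "q = []" | x p' y q' where "p = x # p'" "q = y # q'"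
    by (meson list.exhaust)
  then show ?case
  proof cases
    case 2
    then show ?thesis by (cases p) (simp_all add: span_eval_single)
  next
    case 3
    obtain \<sigma> i \<tau> j where xy: "x = (\<sigma>, i)" "y = (\<tau>, j)" by (metis surj_pair)
    have mem: "p' @ q \<in> words S" "p @ q' \<in> words S" "p' @ q' \<in> words S" "i \<noteq> j"
      using less.prems 3 xy by auto
    show ?thesis
      using less.hyps[OF _ mem(1), of "\<lambda>u. f (apsnd lin_var x # u)"]
        less.hyps[OF _ mem(2), of "\<lambda>u. f (apsnd lin_var y # u)"]
        less.hyps[OF _ mem(3), of "\<lambda>u. f ((\<sigma> \<otimes> \<tau>, lin_var i) # u)"]
        less.hyps[OF _ mem(3), of "\<lambda>u. f ((\<sigma> \<otimes> \<tau>, lin_var j) # u)"] mem(4) 3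
      by (simp add: xy span_eval_add span_eval_diff span_eval_smult span_eval_Cons lin_ratfun_diff absorb_def)
  qed (simp add: span_eval_single)
qed

text \<open>
  The two constants \<open>c = 0\<close> and \<open>c = 1\<close> give the (alternal, alternil) and (symmetral, symmetril)
  conditions.
\<close>

definition symmetric_moulds ::
    "((('g \<times> nat) list \<Rightarrow> ratfun) \<Rightarrow> ('g \<times> nat) list \<Rightarrow> ('g \<times> nat) list \<Rightarrow> ratfun) \<Rightarrow> ratfun \<Rightarrow> 'g mould set" where
  "symmetric_moulds P c = {A \<in> BIMU \<Gamma>. A [] = c \<and>
     (\<forall>p q. p @ q \<in> words UNIV \<longrightarrow> p \<noteq> [] \<longrightarrow> q \<noteq> [] \<longrightarrow>
       P (mould_val A) p q = c * mould_val A p * mould_val A q)}"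

lemma std_words_in_words:
  "\<sigma>s \<in> lists (carrier \<Gamma>) \<Longrightarrow> \<tau>s \<in> lists (carrier \<Gamma>) \<Longrightarrow>
    std_word 0 \<sigma>s @ std_word (length \<sigma>s) \<tau>s \<in> words UNIV"
  using std_word_in_words[of "\<sigma>s @ \<tau>s" 0] unfolding std_word_append by simp

text \<open>The symmetry types are imposed at standard words only, but flexions lead to others. Two
  words with jointly distinct variables are a simultaneous renaming of a standard pair, so
  equivariance spreads the condition.\<close>

lemma symmetric_moulds_eq:
  assumes P: "\<And>f \<pi> p q. natural f \<Longrightarrow> inj \<pi> \<Longrightarrow> p @ q \<in> words UNIV \<Longrightarrow>
      P f (rename \<pi> p) (rename \<pi> q) = rename_ratfun \<pi> (P f p q)"
    and c: "c = 0 \<or> c = 1"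
  shows "symmetric_moulds P c = {A \<in> BIMU \<Gamma>. A [] = c \<and>
     (\<forall>\<sigma>s\<in>lists (carrier \<Gamma>). \<forall>\<tau>s\<in>lists (carrier \<Gamma>). \<sigma>s \<noteq> [] \<longrightarrow> \<tau>s \<noteq> [] \<longrightarrow>
       P (mould_val A) (std_word 0 \<sigma>s) (std_word (length \<sigma>s) \<tau>s)
       = c * mould_val A (std_word 0 \<sigma>s) * mould_val A (std_word (length \<sigma>s) \<tau>s))}" (is "_ = ?R")
proof (intro equalityI subsetI)
  fix A assume A: "A \<in> symmetric_moulds P c"
  have "std_word k \<sigma>s \<noteq> []" if "\<sigma>s \<noteq> []" for k and \<sigma>s :: "'g list"
    using that length_std_word[of k \<sigma>s] by force
  then show "A \<in> ?R"
    using A std_words_in_words unfolding symmetric_moulds_def by blast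
next
  fix A assume A: "A \<in> ?R"
  have nat: "natural (mould_val A)"
    using A by (simp add: natural_mould_val)
  have "P (mould_val A) p q = c * mould_val A p * mould_val A q"
    if pq: "p @ q \<in> words UNIV" "p \<noteq> []" "q \<noteq> []" for p q
  proof -
    obtain \<pi> where \<pi>: "inj \<pi>" "p @ q = rename \<pi> (std_word 0 (map fst (p @ q)))"
      using pq(1) by (rule wordsE)
    let ?p = "std_word 0 (map fst p)" and ?q = "std_word (length (map fst p)) (map fst q)"
    have eq: "p = rename \<pi> ?p" "q = rename \<pi> ?q"
      using \<pi>(2) unfolding map_append std_word_append by (simp_all add: append_eq_append_conv)
    have lists: "map fst p \<in> lists (carrier \<Gamma>)" "map fst q \<in> lists (carrier \<Gamma>)"
      "map fst p \<noteq> []" "map fst q \<noteq> []"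
      using map_fst_words[OF pq(1)] pq by simp_all
    have "std_word 0 (map fst (p @ q)) \<in> words UNIV"
      using map_fst_words[OF pq(1)] by simp
    then have mem: "?p @ ?q \<in> words UNIV"
      unfolding map_append std_word_append by simp
    have "P (mould_val A) (rename \<pi> ?p) (rename \<pi> ?q) = rename_ratfun \<pi> (P (mould_val A) ?p ?q)"
      by (rule P[OF nat \<pi>(1) mem])
    also have "P (mould_val A) ?p ?q = c * mould_val A ?p * mould_val A ?q"
      using A lists pq by blast
    \<comment> \<open>The constant \<open>c\<close> is 0 or 1, hence fixed by every
      renaming.\<close>
    also have "rename_ratfun \<pi> \<dots> = c * mould_val A (rename \<pi> ?p) * mould_val A (rename \<pi> ?q)"
      using c \<pi>(1) lists
      by (auto simp: rename_ratfun_mult rename_ratfun_0 rename_ratfun_1 naturalD(1)[OF nat])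
    finally show ?thesis
      using eq by metis
  qed
  then show "A \<in> symmetric_moulds P c"
    using A unfolding symmetric_moulds_def by blast
qed

lemma ARI_al_eq: "ARI_al \<Gamma> = symmetric_moulds shuffle_val 0"
  by (subst symmetric_moulds_eq)
    (auto simp: ARI_al_def ARI_def shuffle_val_rename mould_sum_eq_span_eval mould_val_def[abs_def] span_eval_shuffle
      simp flip: embed_std_word)

lemma GARI_as_eq: "GARI_as \<Gamma> = symmetric_moulds shuffle_val 1"
  by (subst symmetric_moulds_eq)
    (auto simp: GARI_as_def GARI_def shuffle_val_rename mould_sum_eq_span_eval mould_val_def[abs_def] span_eval_shuffle
      simp flip: embed_std_word)

lemma span_eval_std_stuffle:
  assumes "\<sigma>s \<in> lists (carrier \<Gamma>)" "\<tau>s \<in> lists (carrier \<Gamma>)"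
  shows "span_eval f (stuffle \<Gamma> (embed (std_word 0 \<sigma>s)) (embed (std_word (length \<sigma>s) \<tau>s)))
    = stuffle_val (\<lambda>u. f (embed u)) (std_word 0 \<sigma>s) (std_word (length \<sigma>s) \<tau>s)"
  using std_words_in_words[OF assms] by (rule span_eval_stuffle)

lemma ARI_il_eq: "ARI_il \<Gamma> = symmetric_moulds stuffle_val 0"
  by (subst symmetric_moulds_eq)
    (auto simp: ARI_il_def ARI_def stuffle_val_rename mould_sum_eq_span_eval mould_val_def[abs_def] span_eval_std_stuffle
      simp flip: embed_std_word)

lemma GARI_is_eq: "GARI_is \<Gamma> = symmetric_moulds stuffle_val 1"
  by (subst symmetric_moulds_eq)
    (auto simp: GARI_is_def GARI_def stuffle_val_rename mould_sum_eq_span_eval mould_val_def[abs_def] span_eval_std_stuffle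
      simp flip: embed_std_word)

section \<open>Exchange of the symmetry types\<close>

lemma words_append_sublists:
  "p @ q \<in> words UNIV \<Longrightarrow> a \<in> words (snd ` set p) \<Longrightarrow> b \<in> words (snd ` set q) \<Longrightarrow> a @ b \<in> words UNIV"
  by (simp add: words_def image_Un) blast

lemma words_own_letters: "p \<in> words S \<Longrightarrow> p \<in> words (snd ` set p)"
  by (simp add: words_def)

text \<open>The words a and b reached from p and q use only the variables of p and q respectively,
  so they stay jointly distinct. The shuffle relation applies inside both flexions, and the product
  then factors by linearity.\<close>

lemma flex_symmetric:
  assumes A: "A \<in> symmetric_moulds shuffle_val c"
  shows "mould_of (flex (mould_val A)) \<in> symmetric_moulds stuffle_val c"
proof -
  let ?f = "mould_val A"
  have BIMU: "A \<in> BIMU \<Gamma>" and c: "A [] = c"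
    and sym: "\<And>p q. p @ q \<in> words UNIV \<Longrightarrow> p \<noteq> [] \<Longrightarrow> q \<noteq> [] \<Longrightarrow> shuffle_val ?f p q = c * ?f p * ?f q"
    using A by (auto simp: symmetric_moulds_def)
  have nat: "natural (flex ?f)"
    by (rule natural_flex[OF natural_mould_val[OF BIMU]])
  have "stuffle_val (mould_val (mould_of (flex ?f))) p q
      = c * mould_val (mould_of (flex ?f)) p * mould_val (mould_of (flex ?f)) q"
    if pq: "p @ q \<in> words UNIV" "p \<noteq> []" "q \<noteq> []" for p q
  proof -
    have own: "p \<in> words (snd ` set p)" "q \<in> words (snd ` set q)"
      using pq(1) by (auto intro: words_own_letters)
    have "stuffle_val (mould_val (mould_of (flex ?f))) p q = stuffle_val (flex ?f) p q"
      using pq(1) by (rule stuffle_val_cong) (rule mould_val_mould_of[OF nat])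
    also have "\<dots> = flex (\<lambda>a. flex (\<lambda>b. shuffle_val ?f a b) q) p"
      using pq(1) by (rule stuffle_val_flex)
    also have "\<dots> = flex (\<lambda>a. flex (\<lambda>b. c * ?f a * ?f b) q) p"
      by (intro flex_cong[OF own(1)] flex_cong[OF own(2)] sym words_append_sublists[OF pq(1)]) (use pq in auto)
    also have "\<dots> = c * flex ?f p * flex ?f q"
      by (simp add: flex_scale mult.assoc mult.left_commute[of _ "flex ?f q"] mult.commute[of _ "flex ?f q"])
    finally show ?thesis
      by (simp add: mould_val_mould_of[OF nat own(1)] mould_val_mould_of[OF nat own(2)])
  qed
  moreover have "mould_of (flex ?f) [] = c"
    using c BIMU by (simp add: mould_of_def std_word_def mould_val_Nil)
  ultimately show ?thesis
    using mould_of_in_BIMU[OF nat] by (simp add: symmetric_moulds_def)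
qed

text \<open>The quasi-shuffle relation says that two functions of a pair of words have equal
  flexions in both arguments, at all nonempty words over the variables of p and q. Inverting the
  flexions makes the functions themselves agree at p and q.\<close>

lemma unflex_symmetric:
  assumes A: "A \<in> symmetric_moulds stuffle_val c"
  shows "mould_of (unflex (mould_val A)) \<in> symmetric_moulds shuffle_val c"
proof -
  let ?g = "mould_val A" and ?f = "unflex (mould_val A)"
  have BIMU: "A \<in> BIMU \<Gamma>" and c: "A [] = c"
    and sym: "\<And>p q. p @ q \<in> words UNIV \<Longrightarrow> p \<noteq> [] \<Longrightarrow> q \<noteq> [] \<Longrightarrow> stuffle_val ?g p q = c * ?g p * ?g q"
    using A by (auto simp: symmetric_moulds_def)
  have nat: "natural ?f"
    by (rule natural_unflex[OF natural_mould_val[OF BIMU]])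
  have flex_f: "flex ?f = ?g"
    by (rule ext) (rule flex_unflex)
  \<comment> \<open>The inner \<open>unflex\<close> removes the flexion over \<open>a\<close>, the
    outer one the flexion in the second word.\<close>
  have cancel: "unflex (\<lambda>q'. unflex (\<lambda>p'. flex (\<lambda>a. flex (F a) q') p') p) q = F p q" for F p q
    by (simp add: unflex_flex[of "\<lambda>a. flex (F a) _"] unflex_flex)
  have "shuffle_val (mould_val (mould_of ?f)) p q = c * mould_val (mould_of ?f) p * mould_val (mould_of ?f) q"
    if pq: "p @ q \<in> words UNIV" "p \<noteq> []" "q \<noteq> []" for p q
  proof -
    have own: "p \<in> words (snd ` set p)" "q \<in> words (snd ` set q)"
      using pq(1) by (auto intro: words_own_letters)
    have eq: "flex (\<lambda>a. flex (shuffle_val ?f a) q') p' = flex (\<lambda>a. flex (\<lambda>b. c * ?f a * ?f b) q') p'"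
      if "p' @ q' \<in> words UNIV" "p' \<noteq> []" "q' \<noteq> []" for p' q'
    proof -
      have "flex (\<lambda>a. flex (shuffle_val ?f a) q') p' = stuffle_val ?g p' q'"
        using stuffle_val_flex[OF that(1), of ?f] by (simp add: flex_f)
      also have "\<dots> = c * ?g p' * ?g q'"
        using that by (rule sym)
      also have "\<dots> = flex (\<lambda>a. flex (\<lambda>b. c * ?f a * ?f b) q') p'"
        by (simp add: flex_scale flex_f mult.assoc mult.left_commute[of _ "?g q'"] mult.commute[of _ "?g q'"])
      finally show ?thesis .
    qed
    have "shuffle_val (mould_val (mould_of ?f)) p q = shuffle_val ?f p q"
      using pq(1) by (rule shuffle_val_cong) (rule mould_val_mould_of[OF nat])
    also have "\<dots> = unflex (\<lambda>q'. unflex (\<lambda>p'. flex (\<lambda>a. flex (shuffle_val ?f a) q') p') p) q"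
      by (rule cancel[symmetric])
    also have "\<dots> = unflex (\<lambda>q'. unflex (\<lambda>p'. flex (\<lambda>a. flex (\<lambda>b. c * ?f a * ?f b) q') p') p) q"
      by (intro unflex_cong[OF own(2)] unflex_cong[OF own(1)] eq words_append_sublists[OF pq(1)]) (use pq in auto)
    also have "\<dots> = c * ?f p * ?f q"
      by (rule cancel)
    finally show ?thesis
      by (simp add: mould_val_mould_of[OF nat own(1)] mould_val_mould_of[OF nat own(2)])
  qed
  moreover have "mould_of ?f [] = c"
    using c BIMU by (simp add: mould_of_def std_word_def mould_val_Nil)
  ultimately show ?thesis
    using mould_of_in_BIMU[OF nat] by (simp add: symmetric_moulds_def)
qed

lemma ganit_bij_betw:
  "bij_betw (ganit \<Gamma> (pic \<Gamma>)) (symmetric_moulds shuffle_val c) (symmetric_moulds stuffle_val c)"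
proof (rule bij_betw_byWitness[where f' = "\<lambda>A. mould_of (unflex (mould_val A))"])
  have BIMU: "A \<in> BIMU \<Gamma>" if "A \<in> symmetric_moulds P c" for A P
    using that by (simp add: symmetric_moulds_def)
  show "\<forall>A\<in>symmetric_moulds shuffle_val c. mould_of (unflex (mould_val (ganit \<Gamma> (pic \<Gamma>) A))) = A"
  proof
    fix A assume "A \<in> symmetric_moulds shuffle_val c"
    then obtain f where f: "natural f" "A = mould_of f"
      using BIMU BIMU_E by metis
    have "mould_of (unflex (mould_val (ganit \<Gamma> (pic \<Gamma>) A))) = mould_of (unflex (flex f))"
      unfolding f(2) ganit_mould_of[OF f(1)]
      by (intro mould_of_cong unflex_cong[where S = UNIV] mould_val_mould_of[OF natural_flex[OF f(1)]])
    then show "mould_of (unflex (mould_val (ganit \<Gamma> (pic \<Gamma>) A))) = A"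
      using f(2) by (simp add: unflex_flex cong: mould_of_cong)
  qed
  show "\<forall>A\<in>symmetric_moulds stuffle_val c. ganit \<Gamma> (pic \<Gamma>) (mould_of (unflex (mould_val A))) = A"
    by (simp add: BIMU ganit_mould_of natural_unflex natural_mould_val flex_unflex mould_of_mould_val cong: mould_of_cong)
  show "ganit \<Gamma> (pic \<Gamma>) ` symmetric_moulds shuffle_val c \<subseteq> symmetric_moulds stuffle_val c"
    by (auto simp: ganit_eq BIMU flex_symmetric)
  show "(\<lambda>A. mould_of (unflex (mould_val A))) ` symmetric_moulds stuffle_val c \<subseteq> symmetric_moulds shuffle_val c"
    by (auto simp: unflex_symmetric)
qed

end

theorem theorem3p24:
  fixes \<Gamma> :: "('g, 'b) monoid_scheme"
  assumes "comm_group \<Gamma>" and "finite (carrier \<Gamma>)"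
  shows "ganit \<Gamma> (pic \<Gamma>) \<in> iso ((GARI_group \<Gamma>)\<lparr>carrier := GARI_as \<Gamma>\<rparr>)
                                ((GARI_group \<Gamma>)\<lparr>carrier := GARI_is \<Gamma>\<rparr>)
       \<and> ganit \<Gamma> (pic \<Gamma>) \<in> lie_iso ((ARI_lie \<Gamma>)\<lparr>carrier := ARI_al \<Gamma>\<rparr>)
                                    ((ARI_lie \<Gamma>)\<lparr>carrier := ARI_il \<Gamma>\<rparr>)"
proof -
  interpret comm_group \<Gamma> by (rule assms(1))
  interpret mould_space \<Gamma> ..
  have BIMU: "A \<in> BIMU \<Gamma>" if "A \<in> GARI_as \<Gamma> \<or> A \<in> ARI_al \<Gamma>" for A
    using that by (auto simp: GARI_as_def GARI_def ARI_al_def ARI_def)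
  have bij: "bij_betw (ganit \<Gamma> (pic \<Gamma>)) (GARI_as \<Gamma>) (GARI_is \<Gamma>)"
    "bij_betw (ganit \<Gamma> (pic \<Gamma>)) (ARI_al \<Gamma>) (ARI_il \<Gamma>)"
    by (simp_all add: GARI_as_eq GARI_is_eq ARI_al_eq ARI_il_eq ganit_bij_betw)
  show ?thesis
    \<comment> \<open>The operations are preserved on all of \<open>BIMU\<close>; the symmetry types
      enter only through the bijections, which also supply the membership of images that
      \<open>hom\<close> asks for.\<close>
    using bij bij_betwE[OF bij(1)]
    by (auto simp: iso_def hom_def lie_iso_def GARI_group_def ARI_lie_def BIMU
        ganit_mult ganit_add ganit_smult ganit_bracket)
qed

end
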